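(* Let $k \in \{1,\ldots,N\}$. The kernels $H_0$, $K_0$ and $K_k$ are continuous on $B(0,1)^c$, and belong to $M^\infty_{N-1}(B(0,1)^c)$, $M^\infty_N(B(0,1)^c)$ and $M^\infty_{N+1}(B(0,1)^c)$ respectively.
   Context: $N \geq 2$ is an integer. The Fourier transform convention is $\widehat{f}(\xi) = \int_{\mathbb{R}^N} f(x) e^{-ix\cdot\xi}\,dx$. $H_0$, $K_0$ and $K_k$ ($1 \leq k \leq N$) are the tempered distributions on $\mathbb{R}^N$ whose Fourier transforms are $$\widehat{H_0}(\xi) = \frac{\xi_1}{|\xi|^2+\xi_1^4}, \qquad \widehat{K_0}(\xi) = \frac{\xi_1^2}{|\xi|^2+\xi_1^4}, \qquad \widehat{K_k}(\xi) = \frac{\xi_k\xi_1^2}{|\xi|^2+\xi_1^4}.$$ $B(0,1)$ is the unit ball of $\mathbb{R}^N$ and $B(0,1)^c$ its complement. For $\alpha > 0$ and $\Omega \subset \mathbb{R}^N$, $M^\infty_\alpha(\Omega)$ is the space of functions $u : \Omega \to \mathbb{C}$ such that $\sup\{|x|^\alpha |u(x)| : x \in \Omega\} < +\infty$. Saying that a distribution is continuous on a set, or belongs to $M^\infty_\alpha$ of it, means that it coincides there with a function having this property. *)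

theory Defs
  imports "HOL-Analysis.Analysis"
begin

definition partial_deriv :: "'n::finite \<Rightarrow> (real ^ 'n \<Rightarrow> complex) \<Rightarrow> real ^ 'n \<Rightarrow> complex" where
  "partial_deriv i f x = frechet_derivative f (at x) (axis i 1)"

fun iter_partial :: "'n::finite list \<Rightarrow> (real ^ 'n \<Rightarrow> complex) \<Rightarrow> real ^ 'n \<Rightarrow> complex" where
  "iter_partial [] f = f"
| "iter_partial (i # is) f = partial_deriv i (iter_partial is f)"

text \<open>Since \<^const>\<open>frechet_derivative\<close> is total, smoothness has to require
  differentiability of every iterated partial derivative; this amounts to being of class
  \<open>C\<^sup>\<infinity>\<close>.\<close>

definition smooth :: "(real ^ 'n::finite \<Rightarrow> complex) \<Rightarrow> bool" where
  "smooth f \<longleftrightarrow> (\<forall>is x. iter_partial is f differentiable (at x))"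

definition schwartz :: "(real ^ 'n::finite \<Rightarrow> complex) set" where
  "schwartz = {\<phi>. smooth \<phi> \<and>
     (\<forall>m is. bdd_above (range (\<lambda>x. (1 + norm x) ^ m * norm (iter_partial is \<phi> x))))}"

text \<open>An increasing family of norms defining the usual Frechet topology of the Schwartz space.
  The index set of the sum is finite, and the suprema are finite on \<^const>\<open>schwartz\<close>.\<close>

definition schwartz_norm :: "nat \<Rightarrow> (real ^ 'n::finite \<Rightarrow> complex) \<Rightarrow> real" where
  "schwartz_norm m \<phi> =
     (\<Sum>is | length is \<le> m. SUP x. (1 + norm x) ^ m * norm (iter_partial is \<phi> x))"

text \<open>Distributions are functionals on all functions, of which only the values on
  \<^const>\<open>schwartz\<close> are meaningful; equality of tempered distributions is equality there.\<close>

type_synonym 'n functional = "(real ^ 'n \<Rightarrow> complex) \<Rightarrow> complex"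

definition tempered_distribution :: "'n::finite functional \<Rightarrow> bool" where
  "tempered_distribution T \<longleftrightarrow>
     (\<forall>\<phi>\<in>schwartz. \<forall>\<psi>\<in>schwartz. \<forall>a b.
        T (\<lambda>x. a * \<phi> x + b * \<psi> x) = a * T \<phi> + b * T \<psi>) \<and>
     (\<exists>C m. \<forall>\<phi>\<in>schwartz. norm (T \<phi>) \<le> C * schwartz_norm m \<phi>)"

definition tempered_eq :: "'n::finite functional \<Rightarrow> 'n functional \<Rightarrow> bool" where
  "tempered_eq S T \<longleftrightarrow> (\<forall>\<phi>\<in>schwartz. S \<phi> = T \<phi>)"

definition fourier :: "(real ^ 'n::finite \<Rightarrow> complex) \<Rightarrow> real ^ 'n \<Rightarrow> complex" where
  "fourier f \<xi> = (LINT x|lborel. f x * exp (- \<i> * complex_of_real (x \<bullet> \<xi>)))"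

definition fourier_dist :: "'n::finite functional \<Rightarrow> 'n functional" where
  "fourier_dist T = (\<lambda>\<phi>. T (fourier \<phi>))"

definition regular_dist :: "(real ^ 'n::finite \<Rightarrow> complex) \<Rightarrow> 'n functional" where
  "regular_dist f = (\<lambda>\<phi>. LINT x|lborel. f x * \<phi> x)"

definition test_functions :: "(real ^ 'n::finite) set \<Rightarrow> (real ^ 'n \<Rightarrow> complex) set" where
  "test_functions A = {\<phi>. smooth \<phi> \<and> compact (closure {x. \<phi> x \<noteq> 0}) \<and> closure {x. \<phi> x \<noteq> 0} \<subseteq> A}"

text \<open>Only the values of \<open>f\<close> on \<open>A\<close> matter.\<close>

definition coincides_on :: "'n::finite functional \<Rightarrow> (real ^ 'n) set \<Rightarrow> (real ^ 'n \<Rightarrow> complex) \<Rightarrow> bool" where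
  "coincides_on T A f \<longleftrightarrow>
     (\<forall>K. compact K \<and> K \<subseteq> A \<longrightarrow> set_integrable lborel K f) \<and>
     (\<forall>\<phi>\<in>test_functions A. T \<phi> = regular_dist f \<phi>)"

definition M_infty :: "real \<Rightarrow> (real ^ 'n::finite) set \<Rightarrow> (real ^ 'n \<Rightarrow> complex) set" where
  "M_infty \<alpha> \<Omega> = {u. bdd_above ((\<lambda>x. norm x powr \<alpha> * norm (u x)) ` \<Omega>)}"

text \<open>The index \<open>i\<close> plays the role of the first coordinate; the index type carries no
  ordering, so it is a parameter.\<close>

definition H0_hat :: "'n::finite \<Rightarrow> real ^ 'n \<Rightarrow> complex" where
  "H0_hat i \<xi> = complex_of_real (\<xi> $ i / ((norm \<xi>)\<^sup>2 + (\<xi> $ i) ^ 4))"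

definition K0_hat :: "'n::finite \<Rightarrow> real ^ 'n \<Rightarrow> complex" where
  "K0_hat i \<xi> = complex_of_real ((\<xi> $ i)\<^sup>2 / ((norm \<xi>)\<^sup>2 + (\<xi> $ i) ^ 4))"

definition Kk_hat :: "'n::finite \<Rightarrow> 'n \<Rightarrow> real ^ 'n \<Rightarrow> complex" where
  "Kk_hat i k \<xi> = complex_of_real (\<xi> $ k * (\<xi> $ i)\<^sup>2 / ((norm \<xi>)\<^sup>2 + (\<xi> $ i) ^ 4))"

end

theory Submission
  imports Defs "HOL-Probability.Characteristic_Functions" "HOL-Probability.Sinc_Integral"
    "HOL-Complex_Analysis.Cauchy_Integral_Theorem" "HOL-Real_Asymp.Real_Asymp"
begin

text \<open>
  All three symbols have the form \<open>\<xi>\<^sup>m / P(\<xi>)\<close> with \<open>P(\<xi>) = |\<xi>|\<^sup>2 + \<xi>\<^sub>1\<^sup>4\<close> and a multi-index \<open>m\<close>;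
  with \<open>n = N + |m|\<close> the claim is decay of order \<open>n - 2\<close>, and it holds whenever \<open>n \<ge> 3\<close>
  (\<open>kernel_decay\<close>). The dyadic analysis of an anisotropic symbol is avoided by writing
  \<open>1 / P = \<integral>\<^sub>0\<^sup>\<infinity> exp (- t P) dt\<close>: up to a power of \<open>2\<pi>\<close> the kernel is \<open>\<integral>\<^sub>0\<^sup>\<infinity> k\<^sub>t(x) dt\<close>, where \<open>k\<^sub>t\<close> is the inverse
  transform of \<open>\<xi>\<^sup>m exp (- t P(\<xi>))\<close>, and for fixed \<open>t\<close> everything splits into a product over the
  coordinates.
  
  Each one-dimensional factor is an integral of an entire function with Gaussian decay. Shifting the
  line of integration into the complex plane by \<open>\<plusminus> \<i> a\<close> produces a factor \<open>exp (- a |s|)\<close>, and costs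
  only a constant as long as \<open>a\<^sup>2 t \<le> 1\<close> and \<open>a\<^sup>4 t \<le> 1\<close> (\<open>heat_kernel_bound\<close>). Multiplying the factors,
  \<open>|k\<^sub>t(x)| \<le> C t\<^sup>-\<^sup>n\<^sup>/\<^sup>2 exp (- a |x|)\<close>. The choices \<open>a = 0\<close>, \<open>a = t\<^sup>-\<^sup>1\<^sup>/\<^sup>2\<close> for \<open>t \<ge> 1\<close> (diffusive scaling of
  \<open>|\<xi>|\<^sup>2\<close>) and \<open>a = t\<^sup>-\<^sup>1\<^sup>/\<^sup>4\<close> for \<open>t \<le> 1\<close> (quartic scaling) combine to
  \<open>|k\<^sub>t(x)| \<le> C (|x|\<^sup>2 + t)\<^sup>-\<^sup>n\<^sup>/\<^sup>2\<close> for \<open>|x| \<ge> 1\<close> (\<open>cofourier_heat_multiplier_decay\<close>). The integral of the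
  right-hand side over \<open>t > 0\<close> is a multiple of \<open>|x|\<^sup>2\<^sup>-\<^sup>n\<close>; this gives the decay, and, since the bound
  at \<open>|x| = 1\<close> dominates all the others, also continuity.
  
  It remains to identify \<open>\<integral>\<^sub>0\<^sup>\<infinity> k\<^sub>t dt\<close> with the distribution \<open>T\<close>. A test function \<open>\<phi>\<close> is the Fourier transform of
  the Schwartz function \<open>\<psi>\<close> given by the inversion formula, so \<open>T \<phi>\<close> is the integral of
  \<open>\<psi> \<xi>\<^sup>m / P\<close>. Fubini's theorem brings the integral over \<open>t\<close> to the outside, the multiplication formula
  at fixed \<open>t\<close> replaces \<open>\<integral> \<psi>(\<xi>) \<xi>\<^sup>m exp (- t P(\<xi>)) d\<xi>\<close> by \<open>\<integral> \<phi>(x) k\<^sub>t(x) dx\<close>, and Fubini's theorem brings the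
  integral over \<open>t\<close> back inside (\<open>pairing_with_kernel_fun\<close>). The inversion formula comes from Gaussian regularisation
  (\<open>fourier_cofourier\<close>).
\<close>

section \<open>Integrals over Euclidean space\<close>

text \<open>
  Lebesgue measure on the space is by definition the image of a product measure indexed by the basis
  vectors; the work is only in reindexing from basis vectors to coordinates.
\<close>

lemma
  fixes h :: "'n::finite \<Rightarrow> real \<Rightarrow> 'b::{real_normed_field, banach, second_countable_topology}"
  assumes h: "\<And>l. integrable lborel (h l)"
  shows integrable_lborel_cart_prod: "integrable lborel (\<lambda>x::real^'n. \<Prod>l\<in>UNIV. h l (x $ l))"
    and integral_lborel_cart_prod:
      "(LINT x|lborel. (\<Prod>l\<in>UNIV. h l ((x::real^'n) $ l))) = (\<Prod>l\<in>UNIV. LINT u|lborel. h l u)"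
proof -
  let ?ax = "\<lambda>l::'n. axis l (1::real) :: real^'n"
  let ?e = "\<lambda>f. (\<Sum>b\<in>Basis. f b *\<^sub>R b) :: real^'n"
  define g where "g b = h (the_inv ?ax b)" for b
  have inj: "inj ?ax" by (auto simp: inj_on_def axis_eq_axis)
  have Bas: "(Basis :: (real^'n) set) = range ?ax" by (auto simp: Basis_vec_def)
  have g_ax: "g (?ax l) = h l" for l
    by (simp add: g_def the_inv_f_f[OF inj])
  interpret product_sigma_finite "\<lambda>_::real^'n. lborel :: real measure" ..
  have hm[measurable]: "h l \<in> borel_measurable borel" for l using h[of l] by auto
  have coord: "?e f $ l = f (?ax l)" for f l
  proof -
    have "?e f $ l = ?e f \<bullet> ?ax l" by (simp add: inner_axis)
    also have "\<dots> = f (?ax l)" by (rule inner_sum_left_Basis) (simp add: Bas)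
    finally show ?thesis .
  qed
  have eq: "(\<Prod>l\<in>UNIV. h l (?e f $ l)) = (\<Prod>b\<in>Basis. g b (f b))" for f
  proof -
    have "(\<Prod>l\<in>UNIV. h l (?e f $ l)) = (\<Prod>l\<in>UNIV. g (?ax l) (f (?ax l)))"
      by (simp only: coord g_ax)
    then show ?thesis by (simp add: Bas prod.reindex[OF inj] o_def)
  qed
  have gi: "integrable lborel (g b)" for b by (simp add: g_def h)
  have em: "?e \<in> measurable (\<Pi>\<^sub>M b\<in>Basis. lborel) borel" by measurable
  have pm: "(\<lambda>x::real^'n. \<Prod>l\<in>UNIV. h l (x $ l)) \<in> borel_measurable borel" by measurable
  have int: "integrable (\<Pi>\<^sub>M b\<in>Basis. lborel) (\<lambda>f. \<Prod>b\<in>Basis. g b (f b))"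
    by (rule product_integrable_prod) (auto intro: gi)
  show "integrable lborel (\<lambda>x::real^'n. \<Prod>l\<in>UNIV. h l (x $ l))"
    by (subst lborel_eq, subst integrable_distr_eq[OF em pm], unfold eq) (rule int)
  have "(LINT x|lborel. (\<Prod>l\<in>UNIV. h l ((x::real^'n) $ l))) =
        (LINT f|PiM Basis (\<lambda>_. lborel). (\<Prod>b\<in>Basis. g b (f b)))"
    by (subst lborel_eq, subst integral_distr[OF em pm], unfold eq) (rule refl)
  also have "\<dots> = (\<Prod>b\<in>Basis. LINT u|lborel. g b u)"
    by (rule product_integral_prod) (auto intro: gi)
  also have "\<dots> = (\<Prod>l\<in>UNIV. LINT u|lborel. h l u)"
    by (simp add: Bas prod.reindex[OF inj] g_ax o_def)
  finally show "(LINT x|lborel. (\<Prod>l\<in>UNIV. h l ((x::real^'n) $ l))) = (\<Prod>l\<in>UNIV. LINT u|lborel. h l u)" .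
qed

lemma integral_lborel_affine:
  fixes f :: "'a::euclidean_space \<Rightarrow> complex"
  assumes c: "c \<noteq> 0" and f[measurable]: "f \<in> borel_measurable borel"
  shows "(LINT x|lborel. f x) = \<bar>c\<bar> ^ DIM('a) *\<^sub>R (LINT x|lborel. f (t + c *\<^sub>R x))"
proof -
  have m: "(\<lambda>x. t + c *\<^sub>R x) \<in> measurable lborel borel" by measurable
  have "(LINT x|lborel. f x) = (LINT x|density (distr lborel borel (\<lambda>x. t + c *\<^sub>R x)) (\<lambda>_. ennreal (\<bar>c\<bar> ^ DIM('a))). f x)"
    using lborel_affine[OF c, of t] by simp
  also have "\<dots> = (LINT x|distr lborel borel (\<lambda>x. t + c *\<^sub>R x). \<bar>c\<bar> ^ DIM('a) *\<^sub>R f x)"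
    by (rule integral_density) auto
  also have "\<dots> = \<bar>c\<bar> ^ DIM('a) *\<^sub>R (LINT x|distr lborel borel (\<lambda>x. t + c *\<^sub>R x). f x)"
    by simp
  also have "(LINT x|distr lborel borel (\<lambda>x. t + c *\<^sub>R x). f x) = (LINT x|lborel. f (t + c *\<^sub>R x))"
    by (rule integral_distr[OF m f])
  finally show ?thesis .
qed

text \<open>
  If \<open>f\<close> is not integrable, its integral is \<open>0\<close> by convention and the bound is trivial.
\<close>

lemma norm_integral_le_dominating:
  fixes f :: "'a \<Rightarrow> 'b::{banach, second_countable_topology}"
  assumes g: "integrable M g" and b: "\<And>x. norm (f x) \<le> g x"
  shows "norm (LINT x|M. f x) \<le> (LINT x|M. g x)"
proof (cases "integrable M f")
  case True
  have "norm (LINT x|M. f x) \<le> (LINT x|M. norm (f x))" by (rule integral_norm_bound)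
  also have "\<dots> \<le> (LINT x|M. g x)" by (intro integral_mono integrable_norm True g b)
  finally show ?thesis .
next
  case False
  then show ?thesis
    using order_trans[OF norm_ge_zero b] by (simp add: not_integrable_integral_eq)
qed

text \<open>
  Dominated convergence along sequences; continuity of the Fourier integral and of the final kernel
  are both instances.
\<close>

lemma continuous_on_parametric_integral:
  fixes h :: "'a \<Rightarrow> 'b::{first_countable_topology, t2_space} \<Rightarrow> 'c::{banach, second_countable_topology}"
  assumes cont: "\<And>t. continuous_on S (h t)"
    and meas: "\<And>x. (\<lambda>t. h t x) \<in> borel_measurable M"
    and w: "integrable M w" and bound: "\<And>t x. x \<in> S \<Longrightarrow> norm (h t x) \<le> w t"
  shows "continuous_on S (\<lambda>x. LINT t|M. h t x)"
proof (rule continuous_on_sequentiallyI)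
  fix u a assume u: "\<forall>n. u n \<in> S" "a \<in> S" "u \<longlonglongrightarrow> a"
  show "(\<lambda>n. LINT t|M. h t (u n)) \<longlonglongrightarrow> (LINT t|M. h t a)"
  proof (rule integral_dominated_convergence[OF meas meas w])
    show "AE t in M. (\<lambda>n. h t (u n)) \<longlonglongrightarrow> h t a"
      using cont u by (auto simp: continuous_on_sequentially comp_def)
    show "AE t in M. norm (h t (u n)) \<le> w t" for n using bound u by auto
  qed
qed

section \<open>Fourier integrals and the inversion formula\<close>

text \<open>
  The inverse Fourier integral without its normalising factor \<open>(2\<pi>)\<^sup>-\<^sup>N\<close>, which keeps the
  multiplication formula symmetric.
\<close>

definition cofourier :: "(real ^ 'n::finite \<Rightarrow> complex) \<Rightarrow> real ^ 'n \<Rightarrow> complex" where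
  "cofourier g \<xi> = (LINT x|lborel. g x * cis (x \<bullet> \<xi>))"

lemma fourier_eq_cofourier: "fourier f \<xi> = cofourier f (- \<xi>)"
  by (simp add: fourier_def cofourier_def cis_conv_exp)

lemma borel_measurable_cis [measurable (raw)]:
  "f \<in> borel_measurable M \<Longrightarrow> (\<lambda>x. cis (f x)) \<in> borel_measurable M"
  unfolding cis_conv_exp by measurable

lemma cis_sum: "cis (sum f A) = (\<Prod>l\<in>A. cis (f l))"
  by (induction A rule: infinite_finite_induct) (auto simp flip: cis_mult)

lemma cis_quadratic_remainder: "norm (cis b - 1 - \<i> * of_real b) \<le> b\<^sup>2 / 2"
  using iexp_approx1[of b 1] by (simp add: cis_conv_exp power2_eq_square algebra_simps)

lemma integrable_mult_cis:
  fixes g :: "'a \<Rightarrow> complex"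
  assumes "integrable M g" and "u \<in> borel_measurable M"
  shows "integrable M (\<lambda>x. g x * cis (u x))"
  using assms by (intro Bochner_Integration.integrable_bound[OF assms(1)]) (auto simp: norm_mult)

lemma norm_cofourier_le: "norm (cofourier g \<xi>) \<le> (LINT x|lborel. norm (g x))"
  unfolding cofourier_def
  by (rule order_trans[OF integral_norm_bound]) (simp add: norm_mult)

lemma borel_measurable_cofourier [measurable]:
  assumes [measurable]: "g \<in> borel_measurable borel"
  shows "cofourier g \<in> borel_measurable borel"
  unfolding cofourier_def[abs_def] by measurable

lemma continuous_on_cofourier:
  assumes "integrable lborel g"
  shows "continuous_on S (cofourier g)"
  unfolding cofourier_def[abs_def]
proof (rule continuous_on_parametric_integral)
  show "integrable lborel (\<lambda>x. norm (g x))" using assms by (rule integrable_norm)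
  show "continuous_on S (\<lambda>\<xi>. g x * cis (x \<bullet> \<xi>))" for x
    unfolding cis_conv_exp by (intro continuous_intros)
  show "(\<lambda>x. g x * cis (x \<bullet> \<xi>)) \<in> borel_measurable lborel" for \<xi>
    using integrable_mult_cis[OF assms, of "\<lambda>x. x \<bullet> \<xi>"] by simp
qed (simp add: norm_mult)

lemma integrable_lborel_pair_cis:
  fixes f :: "'a::euclidean_space \<Rightarrow> complex" and g :: "'b::euclidean_space \<Rightarrow> complex"
  assumes f: "integrable lborel f" and g: "integrable lborel g"
    and u: "u \<in> borel_measurable (lborel \<Otimes>\<^sub>M lborel)"
  shows "integrable (lborel \<Otimes>\<^sub>M lborel) (\<lambda>(\<xi>, x). f \<xi> * (g x * cis (u (\<xi>, x))))"
proof -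
  have [measurable]: "f \<in> borel_measurable borel" "g \<in> borel_measurable borel"
    "u \<in> borel_measurable (borel \<Otimes>\<^sub>M borel)" using f g u by auto
  show ?thesis
  proof (rule lborel_pair.Fubini_integrable)
    show "(\<lambda>(\<xi>, x). f \<xi> * (g x * cis (u (\<xi>, x)))) \<in> borel_measurable (lborel \<Otimes>\<^sub>M lborel)"
      by measurable
    show "integrable lborel (\<lambda>\<xi>. LINT x|lborel. norm (case (\<xi>, x) of (\<xi>, x) \<Rightarrow> f \<xi> * (g x * cis (u (\<xi>, x)))))"
      using f by (simp add: norm_mult)
    show "AE \<xi> in lborel. integrable lborel (\<lambda>x. case (\<xi>, x) of (\<xi>, x) \<Rightarrow> f \<xi> * (g x * cis (u (\<xi>, x))))"
      using g by (auto intro!: integrable_mult_right integrable_mult_cis)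
  qed
qed

text \<open>
  This is what transports a pairing from the frequency side to the space side.
\<close>

lemma multiplication_formula:
  assumes f: "integrable lborel f" and g: "integrable lborel g"
  shows "(LINT \<xi>|lborel. f \<xi> * cofourier g \<xi>) = (LINT x|lborel. cofourier f x * g x)"
proof -
  have u: "(\<lambda>(\<xi>, x). x \<bullet> \<xi>) \<in> borel_measurable (lborel \<Otimes>\<^sub>M lborel)" by measurable
  have "(LINT \<xi>|lborel. f \<xi> * cofourier g \<xi>) = (LINT \<xi>|lborel. LINT x|lborel. f \<xi> * (g x * cis (x \<bullet> \<xi>)))"
    by (simp add: cofourier_def)
  also have "\<dots> = (LINT x|lborel. LINT \<xi>|lborel. f \<xi> * (g x * cis (x \<bullet> \<xi>)))"
    using lborel_pair.Fubini_integral[OF integrable_lborel_pair_cis[OF f g u, simplified]] by simp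
  also have "\<dots> = (LINT x|lborel. LINT \<xi>|lborel. (f \<xi> * cis (\<xi> \<bullet> x)) * g x)"
    by (simp add: mult_ac inner_commute)
  also have "\<dots> = (LINT x|lborel. cofourier f x * g x)"
    by (simp add: cofourier_def)
  finally show ?thesis .
qed

definition gaussian :: "real ^ 'n::finite \<Rightarrow> complex" where
  "gaussian x = of_real (exp (- ((norm x)\<^sup>2 / 2)))"

lemma gaussian_prod: "gaussian x = (\<Prod>l\<in>UNIV. of_real (exp (- ((x $ l)\<^sup>2 / 2))))"
proof -
  have "(norm x)\<^sup>2 = (\<Sum>l\<in>UNIV. (x $ l)\<^sup>2)"
    by (simp only: power2_norm_eq_inner inner_vec_def) (simp add: power2_eq_square)
  then show ?thesis
    by (simp add: gaussian_def exp_sum[symmetric] sum_negf sum_divide_distrib flip: of_real_prod)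
qed

lemma borel_measurable_gaussian [measurable]: "gaussian \<in> borel_measurable borel"
  unfolding gaussian_def[abs_def] by measurable

lemma gaussian_real_line:
  shows "integrable lborel (\<lambda>u::real. complex_of_real (exp (- (u\<^sup>2 / 2))))"
    and "(LINT u|lborel. complex_of_real (exp (- (u\<^sup>2 / 2))) * cis (u * s)) =
           of_real (sqrt (2 * pi) * exp (- (s\<^sup>2 / 2)))"
proof -
  have e: "exp (- (u\<^sup>2 / 2)) = sqrt (2 * pi) * std_normal_density u" for u
    by (simp add: std_normal_density_def)
  have "integrable lborel (\<lambda>u::real. exp (- (u\<^sup>2 / 2)))"
    unfolding e using integrable_std_normal_moment[of 0] by simp
  then show "integrable lborel (\<lambda>u::real. complex_of_real (exp (- (u\<^sup>2 / 2))))"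
    by (rule integrable_of_real)
  have "(LINT u|lborel. complex_of_real (exp (- (u\<^sup>2 / 2))) * cis (u * s)) =
      (LINT u|lborel. of_real (sqrt (2 * pi)) * (std_normal_density u *\<^sub>R iexp (s * u)))"
    by (rule Bochner_Integration.integral_cong[OF refl])
       (simp add: e cis_conv_exp scaleR_conv_of_real mult_ac)
  also have "\<dots> = of_real (sqrt (2 * pi)) * (LINT u|lborel. std_normal_density u *\<^sub>R iexp (s * u))"
    by (rule integral_mult_right_zero)
  also have "(LINT u|lborel. std_normal_density u *\<^sub>R iexp (s * u)) = char std_normal_distribution s"
    unfolding char_def by (subst integral_density) auto
  also have "\<dots> = of_real (exp (- (s\<^sup>2 / 2)))" by (simp add: char_std_normal_distribution)
  finally show "(LINT u|lborel. complex_of_real (exp (- (u\<^sup>2 / 2))) * cis (u * s)) =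
           of_real (sqrt (2 * pi) * exp (- (s\<^sup>2 / 2)))" by simp
qed

lemma integrable_gaussian: "integrable lborel (gaussian :: real ^ 'n::finite \<Rightarrow> complex)"
  using integrable_lborel_cart_prod[where 'n='n and h="\<lambda>_ u. complex_of_real (exp (- (u\<^sup>2 / 2)))", OF gaussian_real_line(1)]
  by (simp add: gaussian_prod[abs_def])

lemma cofourier_gaussian:
  "cofourier gaussian (x :: real ^ 'n::finite) = of_real (sqrt (2 * pi) ^ CARD('n)) * gaussian x"
proof -
  let ?h = "\<lambda>l u. complex_of_real (exp (- (u\<^sup>2 / 2))) * cis (u * x $ l)"
  have "integrable lborel (?h l)" for l by (intro integrable_mult_cis gaussian_real_line) auto
  from integral_lborel_cart_prod[of ?h, OF this] show ?thesis
    by (simp add: cofourier_def gaussian_prod inner_vec_def cis_sum prod.distrib gaussian_real_line)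
qed

text \<open>
  Inserting the factor \<open>gaussian (d \<xi>)\<close> makes the iterated integral absolutely convergent. By the
  multiplication formula the regularised integral is a mean of \<open>\<phi>\<close> around \<open>y\<close> with a Gaussian weight of
  width \<open>d\<close>. Letting \<open>d\<close> tend to \<open>0\<close>, the left-hand side converges because \<open>cofourier \<phi>\<close> is integrable and the
  right-hand side because \<open>\<phi>\<close> is bounded and continuous.
\<close>

lemma fourier_cofourier:
  fixes \<phi> :: "real ^ 'n::finite \<Rightarrow> complex"
  assumes \<phi>: "integrable lborel \<phi>" and cont: "continuous_on UNIV \<phi>" and B: "\<And>x. norm (\<phi> x) \<le> B"
    and \<psi>: "integrable lborel (cofourier \<phi>)"
  shows "fourier (cofourier \<phi>) y = of_real ((2 * pi) ^ CARD('n)) * \<phi> y"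
proof (rule LIMSEQ_unique)
  let ?N = "CARD('n)" and ?G = "gaussian :: real ^ 'n \<Rightarrow> complex"
  define S :: complex where "S = of_real (sqrt (2 * pi) ^ ?N)"
  define d where "d n = inverse (real (Suc n))" for n
  have d: "0 < d n" for n by (simp add: d_def)
  have d0: "d \<longlonglongrightarrow> 0" unfolding d_def by (rule LIMSEQ_inverse_real_of_nat)
  have [measurable]: "\<phi> \<in> borel_measurable borel" using \<phi> by auto
  have contG: "continuous_on UNIV ?G" unfolding gaussian_def[abs_def] by (intro continuous_intros) auto
  have G1: "norm (?G x) \<le> 1" for x by (simp add: gaussian_def)
  define f where "f n \<xi> = ?G (d n *\<^sub>R \<xi>) * cis (- (\<xi> \<bullet> y))" for n \<xi>
  have [measurable]: "f n \<in> borel_measurable borel" for n unfolding f_def[abs_def] by measurable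
  have Gsc: "integrable lborel (\<lambda>\<xi>. ?G (d n *\<^sub>R \<xi>))" for n
  proof -
    have "\<bar>d n\<bar> \<noteq> 0" using d[of n] by simp
    then have e: "lborel = density (distr lborel borel (\<lambda>x::real^'n. 0 + d n *\<^sub>R x)) (\<lambda>_. \<bar>d n\<bar> ^ DIM(real^'n))"
      by (intro lborel_affine) simp
    have "integrable (density (distr lborel borel (\<lambda>x::real^'n. 0 + d n *\<^sub>R x)) (\<lambda>_. ennreal (\<bar>d n\<bar> ^ DIM(real^'n)))) ?G"
      using integrable_gaussian by (subst (asm) e)
    then have "integrable lborel (\<lambda>\<xi>. d n ^ ?N *\<^sub>R ?G (d n *\<^sub>R \<xi>))"
      using d[of n] by (subst (asm) integrable_density) (auto simp: integrable_distr_eq)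
    then have "integrable lborel (\<lambda>\<xi>. inverse (d n ^ ?N) *\<^sub>R (d n ^ ?N *\<^sub>R ?G (d n *\<^sub>R \<xi>)))"
      by (rule integrable_scaleR_right)
    moreover have "d n ^ ?N \<noteq> 0" using d[of n] by simp
    ultimately show ?thesis by (simp only: scaleR_scaleR left_inverse scaleR_one not_False_eq_True)
  qed
  have fi: "integrable lborel (f n)" for n unfolding f_def by (intro integrable_mult_cis Gsc) auto
  have cf: "cofourier (f n) x = (1 / d n) ^ ?N *\<^sub>R (S * ?G ((1 / d n) *\<^sub>R (x - y)))" for n x
  proof -
    have "cofourier (f n) x = (LINT \<xi>|lborel. ?G (d n *\<^sub>R \<xi>) * cis (\<xi> \<bullet> (x - y)))"
      unfolding cofourier_def f_def
      by (rule Bochner_Integration.integral_cong) (auto simp: mult.assoc cis_mult inner_diff_right)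
    also have "\<dots> = \<bar>1 / d n\<bar> ^ DIM(real^'n) *\<^sub>R
        (LINT \<xi>|lborel. ?G (d n *\<^sub>R (0 + (1 / d n) *\<^sub>R \<xi>)) * cis ((0 + (1 / d n) *\<^sub>R \<xi>) \<bullet> (x - y)))"
      using d[of n] by (intro integral_lborel_affine) auto
    also have "\<dots> = (1 / d n) ^ ?N *\<^sub>R cofourier ?G ((1 / d n) *\<^sub>R (x - y))"
      using d[of n] by (simp add: cofourier_def)
    finally show ?thesis by (simp add: cofourier_gaussian S_def)
  qed
  have eq: "(LINT \<xi>|lborel. f n \<xi> * cofourier \<phi> \<xi>) = (LINT z|lborel. S * ?G z * \<phi> (y + d n *\<^sub>R z))" for n
  proof -
    have "(LINT \<xi>|lborel. f n \<xi> * cofourier \<phi> \<xi>) = (LINT x|lborel. cofourier (f n) x * \<phi> x)"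
      by (rule multiplication_formula[OF fi \<phi>])
    also have "\<dots> = \<bar>d n\<bar> ^ DIM(real^'n) *\<^sub>R (LINT z|lborel. cofourier (f n) (y + d n *\<^sub>R z) * \<phi> (y + d n *\<^sub>R z))"
      using d[of n] by (intro integral_lborel_affine) auto
    also have "\<dots> = (LINT z|lborel. S * ?G z * \<phi> (y + d n *\<^sub>R z))"
      unfolding cf using d[of n] by (simp add: power_divide)
    finally show ?thesis .
  qed
  have "(\<lambda>n. LINT \<xi>|lborel. f n \<xi> * cofourier \<phi> \<xi>) \<longlonglongrightarrow> (LINT \<xi>|lborel. cofourier \<phi> \<xi> * cis (\<xi> \<bullet> (- y)))"
  proof (rule integral_dominated_convergence)
    show "integrable lborel (\<lambda>\<xi>. norm (cofourier \<phi> \<xi>))" using \<psi> by (rule integrable_norm)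
    show "AE \<xi> in lborel. (\<lambda>n. f n \<xi> * cofourier \<phi> \<xi>) \<longlonglongrightarrow> cofourier \<phi> \<xi> * cis (\<xi> \<bullet> (- y))"
    proof (rule AE_I2)
      fix \<xi> :: "real ^ 'n"
      have "(\<lambda>n. d n *\<^sub>R \<xi>) \<longlonglongrightarrow> 0 *\<^sub>R \<xi>" by (intro tendsto_intros d0)
      then have "(\<lambda>n. ?G (d n *\<^sub>R \<xi>)) \<longlonglongrightarrow> ?G (0 *\<^sub>R \<xi>)"
        by (rule continuous_on_tendsto_compose[OF contG]) auto
      then have "(\<lambda>n. ?G (d n *\<^sub>R \<xi>) * cis (- (\<xi> \<bullet> y)) * cofourier \<phi> \<xi>) \<longlonglongrightarrow> 1 * cis (- (\<xi> \<bullet> y)) * cofourier \<phi> \<xi>"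
        by (intro tendsto_intros) (simp add: gaussian_def)
      then show "(\<lambda>n. f n \<xi> * cofourier \<phi> \<xi>) \<longlonglongrightarrow> cofourier \<phi> \<xi> * cis (\<xi> \<bullet> (- y))"
        by (simp add: f_def mult.commute)
    qed
    show "AE \<xi> in lborel. norm (f n \<xi> * cofourier \<phi> \<xi>) \<le> norm (cofourier \<phi> \<xi>)" for n
      using G1 by (intro AE_I2) (simp add: f_def norm_mult mult_left_le_one_le)
  qed measurable
  then show "(\<lambda>n. LINT z|lborel. S * ?G z * \<phi> (y + d n *\<^sub>R z)) \<longlonglongrightarrow> fourier (cofourier \<phi>) y"
    by (simp add: eq fourier_eq_cofourier cofourier_def[of "cofourier \<phi>"])
  have "(\<lambda>n. LINT z|lborel. S * ?G z * \<phi> (y + d n *\<^sub>R z)) \<longlonglongrightarrow> (LINT z|lborel. S * ?G z * \<phi> y)"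
  proof (rule integral_dominated_convergence)
    show "integrable lborel (\<lambda>z. norm (S * ?G z) * B)"
      by (intro integrable_mult_left integrable_norm integrable_mult_right integrable_gaussian)
    show "AE z in lborel. (\<lambda>n. S * ?G z * \<phi> (y + d n *\<^sub>R z)) \<longlonglongrightarrow> S * ?G z * \<phi> y"
    proof (rule AE_I2)
      fix z :: "real ^ 'n"
      have "(\<lambda>n. y + d n *\<^sub>R z) \<longlonglongrightarrow> y + 0 *\<^sub>R z" by (intro tendsto_intros d0)
      then have "(\<lambda>n. \<phi> (y + d n *\<^sub>R z)) \<longlonglongrightarrow> \<phi> (y + 0 *\<^sub>R z)"
        by (intro continuous_on_tendsto_compose[OF cont]) auto
      then show "(\<lambda>n. S * ?G z * \<phi> (y + d n *\<^sub>R z)) \<longlonglongrightarrow> S * ?G z * \<phi> y"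
        by (intro tendsto_intros) simp
    qed
    show "AE z in lborel. norm (S * ?G z * \<phi> (y + d n *\<^sub>R z)) \<le> norm (S * ?G z) * B" for n
      using B by (intro AE_I2) (simp add: norm_mult mult_left_mono)
  qed measurable
  also have "(LINT z|lborel. S * ?G z * \<phi> y) = S * (LINT z|lborel. ?G z) * \<phi> y" by simp
  also have "(LINT z|lborel. ?G z) = S"
    using cofourier_gaussian[of "0 :: real ^ 'n"] by (simp add: cofourier_def S_def gaussian_def)
  also have "S * S = of_real ((2 * pi) ^ ?N)"
  proof -
    have "sqrt (2 * pi) ^ ?N * sqrt (2 * pi) ^ ?N = (2 * pi) ^ ?N"
      unfolding power_mult_distrib[symmetric] by simp
    then show ?thesis by (simp only: S_def of_real_mult[symmetric])
  qed
  finally show "(\<lambda>n. LINT z|lborel. S * ?G z * \<phi> (y + d n *\<^sub>R z)) \<longlonglongrightarrow> of_real ((2 * pi) ^ ?N) * \<phi> y" .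
qed

section \<open>Smooth functions of compact support\<close>

lemma partial_deriv_eq: "(f has_derivative f') (at x) \<Longrightarrow> partial_deriv l f x = f' (axis l 1)"
  unfolding partial_deriv_def using frechet_derivative_at by metis

text \<open>
  Smoothness quantifies over all iterated partial derivatives. It is easiest to prove for a whole
  class of differentiable functions that is closed under partial differentiation.
\<close>

lemma smooth_coinduct:
  assumes f: "f \<in> S"
    and diff: "\<And>g x. g \<in> S \<Longrightarrow> g differentiable (at x)"
    and step: "\<And>g l. g \<in> S \<Longrightarrow> partial_deriv l g \<in> S"
  shows "smooth f"
proof -
  have "iter_partial is f \<in> S" for "is"
    by (induction "is") (auto intro: f step)
  then show ?thesis by (auto simp: smooth_def intro: diff)
qed

lemma iter_partial_append: "iter_partial (is @ js) f = iter_partial is (iter_partial js f)"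
  by (induction "is") auto

lemma smooth_partial_deriv: "smooth f \<Longrightarrow> smooth (partial_deriv l f)"
  unfolding smooth_def using iter_partial_append[of _ "[l]" f] by (metis iter_partial.simps)

lemma smooth_differentiable: "smooth f \<Longrightarrow> f differentiable (at x)"
  unfolding smooth_def by (metis iter_partial.simps(1))

lemma smooth_continuous_on: "smooth f \<Longrightarrow> continuous_on S f"
  by (meson continuous_at_imp_continuous_on differentiable_imp_continuous_within smooth_differentiable)

text \<open>
  The product rule for a coordinate times \<open>f\<close> returns \<open>f\<close> itself next to its partial derivative, so this
  is the closure needed to apply the coinduction principle to products of a smooth function with
  coordinates.
\<close>

inductive_set coordinate_algebra :: "(real ^ 'n::finite \<Rightarrow> complex) set" where
  base: "smooth f \<Longrightarrow> f \<in> coordinate_algebra"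
| add: "f \<in> coordinate_algebra \<Longrightarrow> g \<in> coordinate_algebra \<Longrightarrow> (\<lambda>x. f x + g x) \<in> coordinate_algebra"
| scale: "f \<in> coordinate_algebra \<Longrightarrow> (\<lambda>x. c * f x) \<in> coordinate_algebra"
| coord: "f \<in> coordinate_algebra \<Longrightarrow> (\<lambda>x. of_real (x $ i) * f x) \<in> coordinate_algebra"

lemma coordinate_algebra_deriv:
  assumes "f \<in> coordinate_algebra"
  shows "(\<forall>x. f differentiable (at x)) \<and> (\<forall>l. partial_deriv l f \<in> coordinate_algebra)"
  using assms
proof induction
  case (base f)
  then show ?case
    by (auto intro: coordinate_algebra.base smooth_partial_deriv smooth_differentiable)
next
  case (add f g)
  have D: "((\<lambda>x. f x + g x) has_derivative (\<lambda>h. frechet_derivative f (at x) h + frechet_derivative g (at x) h)) (at x)" for x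
    using add by (intro has_derivative_add) (auto simp: frechet_derivative_works)
  have "partial_deriv l (\<lambda>x. f x + g x) = (\<lambda>x. partial_deriv l f x + partial_deriv l g x)" for l
    using partial_deriv_eq[OF D] by (auto simp: partial_deriv_def)
  then show ?case
    using D add by (auto simp: differentiable_def intro: coordinate_algebra.add)
next
  case (scale f c)
  have D: "((\<lambda>x. c * f x) has_derivative (\<lambda>h. c * frechet_derivative f (at x) h)) (at x)" for x
    using scale by (intro has_derivative_mult_right) (auto simp: frechet_derivative_works)
  have "partial_deriv l (\<lambda>x. c * f x) = (\<lambda>x. c * partial_deriv l f x)" for l
    using partial_deriv_eq[OF D] by (auto simp: partial_deriv_def)
  then show ?case
    using D scale by (auto simp: differentiable_def intro: coordinate_algebra.scale)
next
  case (coord f i)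
  have D: "((\<lambda>x. of_real (x $ i) * f x) has_derivative
      (\<lambda>h. of_real (x $ i) * frechet_derivative f (at x) h + of_real (h $ i) * f x)) (at x)" for x
    using coord
    by (intro has_derivative_mult bounded_linear_imp_has_derivative
          bounded_linear_compose[OF bounded_linear_of_real bounded_linear_vec_nth])
       (auto simp: frechet_derivative_works)
  have "partial_deriv l (\<lambda>x. of_real (x $ i) * f x) =
      (\<lambda>x. of_real (x $ i) * partial_deriv l f x + (if l = i then 1 else 0) * f x)" for l
    using partial_deriv_eq[OF D] by (auto simp: partial_deriv_def axis_def)
  moreover have "(\<lambda>x. of_real (x $ i) * partial_deriv l f x + (if l = i then 1 else 0) * f x) \<in> coordinate_algebra" for l
    using coord by (intro coordinate_algebra.add coordinate_algebra.coord coordinate_algebra.scale) auto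
  ultimately show ?case using D by (auto simp: differentiable_def)
qed

lemma coordinate_algebra_smooth: "f \<in> coordinate_algebra \<Longrightarrow> smooth f"
  by (erule smooth_coinduct) (use coordinate_algebra_deriv in blast)+

text \<open>
  Differentiating a Fourier integral multiplies the function by a coordinate, and multiplying the
  integral by a coordinate differentiates the function; this class is closed under both.
\<close>

definition smooth_compact :: "(real ^ 'n::finite \<Rightarrow> complex) set" where
  "smooth_compact = {f. smooth f \<and> (\<exists>R. \<forall>x. R < norm x \<longrightarrow> f x = 0)}"

lemma test_functions_smooth_compact: "test_functions A \<subseteq> smooth_compact"
proof
  fix \<phi> assume \<phi>: "\<phi> \<in> test_functions A"
  then have "bounded (closure {x. \<phi> x \<noteq> 0})" by (auto simp: test_functions_def compact_imp_bounded)
  then obtain R where "\<And>x. x \<in> closure {x. \<phi> x \<noteq> 0} \<Longrightarrow> norm x \<le> R" by (auto simp: bounded_iff)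
  then have "\<phi> x = 0" if "R < norm x" for x
    using that closure_subset[of "{x. \<phi> x \<noteq> 0}"] by force
  then show "\<phi> \<in> smooth_compact" using \<phi> by (auto simp: smooth_compact_def test_functions_def)
qed

lemma smooth_compact_scale: "f \<in> smooth_compact \<Longrightarrow> (\<lambda>x. c * f x) \<in> smooth_compact"
  unfolding smooth_compact_def
  by (auto intro!: coordinate_algebra_smooth coordinate_algebra.intros)

lemma smooth_compact_coord: "f \<in> smooth_compact \<Longrightarrow> (\<lambda>x. of_real (x $ i) * f x) \<in> smooth_compact"
  unfolding smooth_compact_def
  by (auto intro!: coordinate_algebra_smooth coordinate_algebra.intros)

lemma smooth_compact_partial_deriv:
  assumes f: "f \<in> smooth_compact"
  shows "partial_deriv l f \<in> smooth_compact"
proof -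
  from f obtain R where s: "smooth f" and R: "\<And>x. R < norm x \<Longrightarrow> f x = 0"
    by (auto simp: smooth_compact_def)
  have "partial_deriv l f x = 0" if x: "R < norm x" for x
  proof -
    have "open {y::real^'a. R < norm y}" by (intro open_Collect_less continuous_intros)
    then have "(f has_derivative (\<lambda>_. 0)) (at x)"
      by (rule has_derivative_transform_within_open[OF has_derivative_const[of 0]]) (use x R in auto)
    then show ?thesis using partial_deriv_eq by fastforce
  qed
  then show ?thesis using s smooth_partial_deriv unfolding smooth_compact_def by blast
qed

lemma compact_support_integrable:
  fixes f :: "real ^ 'n::finite \<Rightarrow> 'b::{banach, second_countable_topology}"
  assumes c: "continuous_on UNIV f" and R: "\<And>x. R < norm x \<Longrightarrow> f x = 0"
  shows "integrable lborel f"
proof -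
  have "integrable lborel (\<lambda>x. indicator (cball 0 R) x *\<^sub>R f x)"
    by (intro borel_integrable_compact continuous_on_subset[OF c]) auto
  also have "(\<lambda>x. indicator (cball 0 R) x *\<^sub>R f x) = f"
    using R by (auto simp: indicator_def dist_norm)
  finally show ?thesis .
qed

lemma smooth_compact_integrable: "f \<in> smooth_compact \<Longrightarrow> integrable lborel f"
  unfolding smooth_compact_def using compact_support_integrable smooth_continuous_on by blast

lemma smooth_compact_bounded:
  assumes f: "f \<in> smooth_compact"
  obtains B where "\<And>x. norm (f x) \<le> B"
proof -
  from f obtain R where s: "smooth f" and R: "\<And>x. R < norm x \<Longrightarrow> f x = 0"
    by (auto simp: smooth_compact_def)
  have "compact (f ` cball 0 R)"
    by (intro compact_continuous_image smooth_continuous_on s compact_cball)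
  then obtain B where B: "\<And>x. x \<in> cball 0 R \<Longrightarrow> norm (f x) \<le> B"
    by (meson bounded_iff compact_imp_bounded image_eqI)
  \<comment> \<open>If \<open>R < 0\<close> the ball is empty and \<open>B\<close> may be negative.\<close>
  have "norm (f x) \<le> max B 0" for x
    using B[of x] R[of x] by (cases "norm x \<le> R") (auto simp: le_max_iff_disj)
  then show ?thesis by (rule that)
qed

section \<open>Fourier integrals of smooth functions of compact support\<close>

text \<open>
  Translating \<open>f\<close> multiplies its Fourier integral by a phase, so the identity holds for difference
  quotients without any boundary terms. In the limit the quotients of \<open>f\<close> are dominated by a multiple
  of the indicator of a ball (mean value theorem), and the quotients of the phase are controlled by the
  Taylor remainder of \<open>cis\<close>.
\<close>

lemma cofourier_partial_deriv:
  fixes f :: "real ^ 'n::finite \<Rightarrow> complex"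
  assumes f: "f \<in> smooth_compact"
  shows "cofourier (partial_deriv l f) \<xi> = - (\<i> * of_real (\<xi> $ l)) * cofourier f \<xi>"
proof (rule LIMSEQ_unique)
  from f obtain R where s: "smooth f" and R: "\<And>x. R < norm x \<Longrightarrow> f x = 0"
    by (auto simp: smooth_compact_def)
  obtain M where M: "\<And>x. norm (partial_deriv l f x) \<le> M"
    using smooth_compact_bounded[OF smooth_compact_partial_deriv[OF f, of l]] by blast
  have M0: "0 \<le> M" using order_trans[OF norm_ge_zero M] .
  define e :: "real ^ 'n" where "e = axis l 1"
  have e1: "norm e = 1" by (simp add: e_def)
  define d where "d n = inverse (real (Suc n))" for n
  have d: "0 < d n" "d n \<le> 1" for n by (auto simp: d_def inverse_le_1_iff)
  have d0: "d \<longlonglongrightarrow> 0" unfolding d_def by (rule LIMSEQ_inverse_real_of_nat)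
  have fD: "(f has_derivative frechet_derivative f (at x)) (at x)" for x
    using smooth_differentiable[OF s] by (simp add: frechet_derivative_works)
  have [measurable]: "f \<in> borel_measurable borel"
    using smooth_continuous_on[OF s] by (rule borel_measurable_continuous_onI)
  have [measurable]: "partial_deriv l f \<in> borel_measurable borel"
    using smooth_continuous_on[OF smooth_partial_deriv[OF s]] by (rule borel_measurable_continuous_onI)
  define q where "q n x = (f (x + d n *\<^sub>R e) - f x) /\<^sub>R d n" for n x
  have q_lim: "(\<lambda>n. q n x) \<longlonglongrightarrow> partial_deriv l f x" for x
  proof -
    have lin: "linear (frechet_derivative f (at x))"
      using fD has_derivative_linear by blast
    have "((\<lambda>h. norm (f (x + h) - f x - frechet_derivative f (at x) h) / norm h) \<longlongrightarrow> 0) (at 0)"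
      using fD[of x] by (simp add: has_derivative_at)
    moreover have "filterlim (\<lambda>n. d n *\<^sub>R e) (at 0) sequentially"
      using d d0 e1 tendsto_scaleR[OF d0 tendsto_const[of e]]
      by (auto simp: filterlim_at less_imp_neq[symmetric])
    ultimately have "(\<lambda>n. norm (f (x + d n *\<^sub>R e) - f x - frechet_derivative f (at x) (d n *\<^sub>R e)) / norm (d n *\<^sub>R e)) \<longlonglongrightarrow> 0"
      by (rule filterlim_compose)
    moreover have "norm (f (x + d n *\<^sub>R e) - f x - frechet_derivative f (at x) (d n *\<^sub>R e)) / norm (d n *\<^sub>R e) = norm (q n x - partial_deriv l f x)" for n
    proof -
      have "q n x - partial_deriv l f x = (f (x + d n *\<^sub>R e) - f x - frechet_derivative f (at x) (d n *\<^sub>R e)) /\<^sub>R d n"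
        using d[of n] by (simp add: q_def partial_deriv_def e_def linear_cmul[OF lin] scaleR_diff_right)
      then show ?thesis using d[of n] e1 by (simp add: divide_inverse mult.commute)
    qed
    ultimately show ?thesis by (simp add: LIM_zero_iff tendsto_norm_zero_iff)
  qed
  have far: "R < norm (x + d n *\<^sub>R e)" if "R + 1 < norm x" for x n
  proof -
    have "norm (d n *\<^sub>R e) \<le> 1" using d[of n] e1 by simp
    moreover have "norm x \<le> norm (x + d n *\<^sub>R e) + norm (d n *\<^sub>R e)"
      using norm_triangle_ineq4[of "x + d n *\<^sub>R e" "d n *\<^sub>R e"] by simp
    ultimately show ?thesis using that by simp
  qed
  have q_bound: "norm (q n x) \<le> indicator (cball 0 (R + 1)) x * M" for n x
  proof (cases "norm x \<le> R + 1")
    case True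
    have "\<exists>\<tau>\<in>{0<..<d n}. norm (f (x + d n *\<^sub>R e) - f (x + 0 *\<^sub>R e)) \<le> norm (frechet_derivative f (at (x + \<tau> *\<^sub>R e)) ((d n - 0) *\<^sub>R e))"
    proof (rule mvt_general[of 0 "d n" "\<lambda>\<tau>. f (x + \<tau> *\<^sub>R e)" "\<lambda>\<tau> h. frechet_derivative f (at (x + \<tau> *\<^sub>R e)) (h *\<^sub>R e)"])
      show "continuous_on {0..d n} (\<lambda>\<tau>. f (x + \<tau> *\<^sub>R e))"
        by (rule continuous_on_compose2[OF smooth_continuous_on[OF s, of UNIV]]) (auto intro!: continuous_intros)
      show "((\<lambda>\<tau>. f (x + \<tau> *\<^sub>R e)) has_derivative (\<lambda>h. frechet_derivative f (at (x + \<tau> *\<^sub>R e)) (h *\<^sub>R e))) (at \<tau>)" for \<tau>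
        by (rule has_derivative_compose[OF _ fD, of "\<lambda>\<tau>. x + \<tau> *\<^sub>R e" "\<lambda>h. h *\<^sub>R e"])
           (auto intro!: derivative_eq_intros)
    qed (rule d)
    then obtain \<tau> where "norm (f (x + d n *\<^sub>R e) - f x) \<le> norm (frechet_derivative f (at (x + \<tau> *\<^sub>R e)) (d n *\<^sub>R e))"
      by auto
    also have "frechet_derivative f (at (x + \<tau> *\<^sub>R e)) (d n *\<^sub>R e) = d n *\<^sub>R partial_deriv l f (x + \<tau> *\<^sub>R e)"
      using linear_cmul[OF has_derivative_linear[OF fD]] by (simp add: partial_deriv_def e_def)
    also have "norm \<dots> \<le> d n * M" using d[of n] M by (simp add: mult_left_mono)
    finally have "norm (q n x) \<le> M" using d[of n]
      unfolding q_def norm_scaleR by (simp add: inverse_eq_divide pos_divide_le_eq mult.commute)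
    then show ?thesis using True by (simp add: dist_norm)
  next
    case False
    then have "R < norm x" "R < norm (x + d n *\<^sub>R e)" using far[of x n] by auto
    then show ?thesis using R M0 by (simp add: q_def)
  qed
  have fi: "integrable lborel f" by (rule smooth_compact_integrable[OF f])
  have q_int: "(LINT x|lborel. q n x * cis (x \<bullet> \<xi>)) = (cis (- (d n * \<xi> $ l)) - 1) /\<^sub>R d n * cofourier f \<xi>" for n
  proof -
    have e\<xi>: "e \<bullet> \<xi> = \<xi> $ l" by (simp add: e_def inner_axis')
    have sh: "integrable lborel (\<lambda>x. f (x + d n *\<^sub>R e))"
    proof (rule compact_support_integrable[where R="R + 1"])
      show "continuous_on UNIV (\<lambda>x. f (x + d n *\<^sub>R e))"
        by (rule continuous_on_compose2[OF smooth_continuous_on[OF s, of UNIV]]) (auto intro!: continuous_intros)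
    qed (simp add: R far)
    have "(LINT x|lborel. f x * cis ((x - d n *\<^sub>R e) \<bullet> \<xi>)) = \<bar>1\<bar> ^ DIM(real^'n) *\<^sub>R
        (LINT x|lborel. f (d n *\<^sub>R e + 1 *\<^sub>R x) * cis ((d n *\<^sub>R e + 1 *\<^sub>R x - d n *\<^sub>R e) \<bullet> \<xi>))"
      by (rule integral_lborel_affine) auto
    then have 1: "(LINT x|lborel. f (x + d n *\<^sub>R e) * cis (x \<bullet> \<xi>)) = (LINT x|lborel. f x * cis ((x - d n *\<^sub>R e) \<bullet> \<xi>))"
      by (simp add: add.commute)
    have "\<dots> = (LINT x|lborel. cis (- (d n * \<xi> $ l)) * (f x * cis (x \<bullet> \<xi>)))"
      by (rule Bochner_Integration.integral_cong)
         (simp_all add: inner_diff_left e\<xi> cis_mult mult.left_commute)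
    then have 2: "(LINT x|lborel. f (x + d n *\<^sub>R e) * cis (x \<bullet> \<xi>)) = cis (- (d n * \<xi> $ l)) * cofourier f \<xi>"
      using 1 by (simp add: cofourier_def)
    have "(LINT x|lborel. q n x * cis (x \<bullet> \<xi>)) =
        (LINT x|lborel. (f (x + d n *\<^sub>R e) * cis (x \<bullet> \<xi>) - f x * cis (x \<bullet> \<xi>)) /\<^sub>R d n)"
      by (rule Bochner_Integration.integral_cong) (simp_all add: q_def algebra_simps)
    also have "\<dots> = (cis (- (d n * \<xi> $ l)) * cofourier f \<xi> - cofourier f \<xi>) /\<^sub>R d n"
      using 2 fi sh by (simp add: Bochner_Integration.integral_diff integrable_mult_cis cofourier_def[of f])
    finally show ?thesis by (simp add: algebra_simps)
  qed
  have "(\<lambda>n. LINT x|lborel. q n x * cis (x \<bullet> \<xi>)) \<longlonglongrightarrow> (LINT x|lborel. partial_deriv l f x * cis (x \<bullet> \<xi>))"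
  proof (rule integral_dominated_convergence)
    show "integrable lborel (\<lambda>x. indicator (cball 0 (R + 1)) x * M)"
      by (intro integrable_mult_left integrable_real_indicator)
         (simp_all add: emeasure_lborel_cball_finite[unfolded infinity_ennreal_def])
    show "AE x in lborel. (\<lambda>n. q n x * cis (x \<bullet> \<xi>)) \<longlonglongrightarrow> partial_deriv l f x * cis (x \<bullet> \<xi>)"
      by (intro AE_I2 tendsto_intros q_lim)
    show "AE x in lborel. norm (q n x * cis (x \<bullet> \<xi>)) \<le> indicator (cball 0 (R + 1)) x * M" for n
      using q_bound by (intro AE_I2) (simp add: norm_mult)
    show "(\<lambda>x. q n x * cis (x \<bullet> \<xi>)) \<in> borel_measurable lborel" for n
      unfolding q_def by measurable
  qed measurable
  then show "(\<lambda>n. LINT x|lborel. q n x * cis (x \<bullet> \<xi>)) \<longlonglongrightarrow> cofourier (partial_deriv l f) \<xi>"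
    by (simp add: cofourier_def)
  have "(\<lambda>n. (cis (- (d n * \<xi> $ l)) - 1) /\<^sub>R d n) \<longlonglongrightarrow> - (\<i> * of_real (\<xi> $ l))"
  proof (rule LIM_zero_cancel, rule Lim_null_comparison)
    show "(\<lambda>n. d n * ((\<xi> $ l)\<^sup>2 / 2)) \<longlonglongrightarrow> 0"
      using d0 by (rule tendsto_mult_left_zero)
    show "\<forall>\<^sub>F n in sequentially. norm ((cis (- (d n * \<xi> $ l)) - 1) /\<^sub>R d n - - (\<i> * of_real (\<xi> $ l))) \<le> d n * ((\<xi> $ l)\<^sup>2 / 2)"
    proof (intro always_eventually allI)
      fix n
      let ?b = "- (d n * \<xi> $ l)"
      have "(cis ?b - 1) /\<^sub>R d n - - (\<i> * of_real (\<xi> $ l)) = (cis ?b - 1 - \<i> * of_real ?b) /\<^sub>R d n"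
        using d[of n] by (simp add: scaleR_conv_of_real field_simps)
      also have "norm \<dots> = norm (cis ?b - 1 - \<i> * of_real ?b) / d n"
        using d[of n] by (simp add: divide_inverse mult.commute)
      also have "\<dots> \<le> (?b\<^sup>2 / 2) / d n"
        using d[of n] by (intro divide_right_mono cis_quadratic_remainder) auto
      also have "\<dots> = d n * ((\<xi> $ l)\<^sup>2 / 2)" using d[of n] by (simp add: power2_eq_square field_simps)
      finally show "norm ((cis ?b - 1) /\<^sub>R d n - - (\<i> * of_real (\<xi> $ l))) \<le> d n * ((\<xi> $ l)\<^sup>2 / 2)" .
    qed
  qed
  then have "(\<lambda>n. (cis (- (d n * \<xi> $ l)) - 1) /\<^sub>R d n * cofourier f \<xi>) \<longlonglongrightarrow> - (\<i> * of_real (\<xi> $ l)) * cofourier f \<xi>"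
    by (intro tendsto_intros)
  then show "(\<lambda>n. LINT x|lborel. q n x * cis (x \<bullet> \<xi>)) \<longlonglongrightarrow> - (\<i> * of_real (\<xi> $ l)) * cofourier f \<xi>"
    by (simp only: q_int)
qed

text \<open>
  One more power of \<open>1 + norm \<xi>\<close> is bounded by \<open>1\<close> plus the sum of the \<open>\<bar>\<xi>\<^sub>l\<bar>\<close>, and each
  of these factors is absorbed by a derivative of \<open>f\<close>.
\<close>

lemma cofourier_rapid_decay:
  fixes f :: "real ^ 'n::finite \<Rightarrow> complex"
  assumes "f \<in> smooth_compact"
  shows "\<exists>K. \<forall>\<xi>. (1 + norm \<xi>) ^ m * norm (cofourier f \<xi>) \<le> K"
  using assms
proof (induction m arbitrary: f)
  case 0
  then show ?case using norm_cofourier_le by auto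
next
  case (Suc m)
  obtain K0 where K0: "\<And>\<xi>. (1 + norm \<xi>) ^ m * norm (cofourier f \<xi>) \<le> K0" using Suc by blast
  have "\<forall>l. \<exists>K. \<forall>\<xi>. (1 + norm \<xi>) ^ m * norm (cofourier (partial_deriv l f) \<xi>) \<le> K"
    using Suc smooth_compact_partial_deriv by blast
  then obtain K where K: "\<And>l \<xi>. (1 + norm \<xi>) ^ m * norm (cofourier (partial_deriv l f) \<xi>) \<le> K l"
    by metis
  have "(1 + norm \<xi>) ^ Suc m * norm (cofourier f \<xi>) \<le> K0 + (\<Sum>l\<in>UNIV. K l)" for \<xi>
  proof -
    let ?a = "(1 + norm \<xi>) ^ m" and ?F = "norm (cofourier f \<xi>)"
    have "(1 + norm \<xi>) ^ Suc m * ?F = ?a * ?F + norm \<xi> * (?a * ?F)" by (simp add: algebra_simps)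
    also have "\<dots> \<le> ?a * ?F + (\<Sum>l\<in>UNIV. \<bar>\<xi> $ l\<bar>) * (?a * ?F)"
      by (intro add_left_mono mult_right_mono norm_le_l1_cart) auto
    also have "(\<Sum>l\<in>UNIV. \<bar>\<xi> $ l\<bar>) * (?a * ?F) = (\<Sum>l\<in>UNIV. ?a * norm (cofourier (partial_deriv l f) \<xi>))"
      unfolding sum_distrib_right
      by (intro sum.cong refl) (simp add: cofourier_partial_deriv[OF Suc.prems] norm_mult mult_ac)
    also have "?a * ?F + \<dots> \<le> K0 + (\<Sum>l\<in>UNIV. K l)" by (intro add_mono sum_mono K0 K)
    finally show ?thesis .
  qed
  then show ?case by blast
qed

text \<open>
  Taylor's formula for \<open>cis\<close> leaves a remainder of at most \<open>C (norm v)\<^sup>2 / 2\<close>, with \<open>C\<close> the second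
  moment of \<open>norm (f x)\<close>. The derivative is written as a sum over the coordinates so that its
  linearity and boundedness are evident.
\<close>

lemma cofourier_has_derivative:
  fixes f :: "real ^ 'n::finite \<Rightarrow> complex"
  assumes f: "f \<in> smooth_compact"
  shows "(cofourier f has_derivative
    (\<lambda>v. \<Sum>l\<in>UNIV. of_real (v $ l) * cofourier (\<lambda>x. \<i> * (of_real (x $ l) * f x)) \<xi>)) (at \<xi>)"
proof (rule has_derivativeI_sandwich[of 1])
  let ?f = "\<lambda>l x. \<i> * (of_real (x $ l) * f x)"
  from f obtain R where s: "smooth f" and R: "\<And>x. R < norm x \<Longrightarrow> f x = 0"
    by (auto simp: smooth_compact_def)
  define C where "C = (LINT x|lborel. (norm x)\<^sup>2 * norm (f x))"
  have Ci: "integrable lborel (\<lambda>x. (norm x)\<^sup>2 * norm (f x))"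
    by (rule compact_support_integrable[where R=R]) (auto intro!: continuous_intros smooth_continuous_on[OF s] simp: R)
  show "bounded_linear (\<lambda>v. \<Sum>l\<in>UNIV. of_real (v $ l) * cofourier (?f l) \<xi>)"
    by (intro bounded_linear_sum bounded_linear_mult_const
          bounded_linear_compose[OF bounded_linear_of_real bounded_linear_vec_nth])
  show "((\<lambda>y. C / 2 * norm (y - \<xi>)) \<longlongrightarrow> 0) (at \<xi>)"
    by (auto intro!: tendsto_eq_intros)
  fix y assume y: "y \<noteq> \<xi>"
  define v where "v = y - \<xi>"
  have v: "0 < norm v" "y = \<xi> + v" using y by (auto simp: v_def)
  have fi: "integrable lborel f" by (rule smooth_compact_integrable[OF f])
  have fli: "integrable lborel (?f l)" for l
    by (intro smooth_compact_integrable smooth_compact_scale smooth_compact_coord f)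
  have "(\<Sum>l\<in>UNIV. of_real (v $ l) * cofourier (?f l) \<xi>) = (LINT x|lborel. (\<Sum>l\<in>UNIV. of_real (v $ l) * (?f l x * cis (x \<bullet> \<xi>))))"
    unfolding cofourier_def
    by (subst Bochner_Integration.integral_sum)
       (auto intro!: integrable_mult_right integrable_mult_cis fli)
  also have "\<dots> = (LINT x|lborel. f x * cis (x \<bullet> \<xi>) * (\<i> * of_real (x \<bullet> v)))"
    by (rule Bochner_Integration.integral_cong)
       (simp_all add: inner_vec_def sum_distrib_left sum_distrib_right mult_ac)
  finally have L: "(\<Sum>l\<in>UNIV. of_real (v $ l) * cofourier (?f l) \<xi>) = (LINT x|lborel. f x * cis (x \<bullet> \<xi>) * (\<i> * of_real (x \<bullet> v)))" .
  have Li: "integrable lborel (\<lambda>x. f x * cis (x \<bullet> \<xi>) * (\<i> * of_real (x \<bullet> v)))"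
    by (rule compact_support_integrable[where R=R])
       (auto intro!: continuous_intros smooth_continuous_on[OF s] simp: R cis_conv_exp)
  have "cofourier f y - cofourier f \<xi> - (\<Sum>l\<in>UNIV. of_real (v $ l) * cofourier (?f l) \<xi>) =
      (LINT x|lborel. f x * cis (x \<bullet> y) - f x * cis (x \<bullet> \<xi>) - f x * cis (x \<bullet> \<xi>) * (\<i> * of_real (x \<bullet> v)))"
    unfolding L unfolding cofourier_def
    using fi Li by (simp add: Bochner_Integration.integral_diff integrable_mult_cis)
  also have "\<dots> = (LINT x|lborel. f x * cis (x \<bullet> \<xi>) * (cis (x \<bullet> v) - 1 - \<i> * of_real (x \<bullet> v)))"
    by (rule Bochner_Integration.integral_cong)
       (simp_all add: v(2) inner_add_right algebra_simps flip: cis_mult)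
  also have "norm \<dots> \<le> (LINT x|lborel. (norm x)\<^sup>2 * norm (f x) * ((norm v)\<^sup>2 / 2))"
  proof (rule norm_integral_le_dominating)
    show "norm (f x * cis (x \<bullet> \<xi>) * (cis (x \<bullet> v) - 1 - \<i> * of_real (x \<bullet> v))) \<le> (norm x)\<^sup>2 * norm (f x) * ((norm v)\<^sup>2 / 2)" for x
    proof -
      have "(x \<bullet> v)\<^sup>2 \<le> (norm x * norm v)\<^sup>2"
        using Cauchy_Schwarz_ineq2[of x v] by (metis abs_ge_zero power2_abs power_mono)
      then have "norm (cis (x \<bullet> v) - 1 - \<i> * of_real (x \<bullet> v)) \<le> (norm x * norm v)\<^sup>2 / 2"
        using cis_quadratic_remainder[of "x \<bullet> v"] by linarith
      then have "norm (f x) * norm (cis (x \<bullet> v) - 1 - \<i> * of_real (x \<bullet> v)) \<le> norm (f x) * ((norm x * norm v)\<^sup>2 / 2)"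
        by (rule mult_left_mono) simp
      then show ?thesis by (simp add: norm_mult power_mult_distrib mult_ac)
    qed
  qed (intro integrable_mult_left Ci)
  also have "\<dots> = C * ((norm v)\<^sup>2 / 2)" by (simp add: C_def)
  finally have "norm (cofourier f y - cofourier f \<xi> - (\<Sum>l\<in>UNIV. of_real (v $ l) * cofourier (?f l) \<xi>)) / norm v
      \<le> C * ((norm v)\<^sup>2 / 2) / norm v"
    by (rule divide_right_mono) simp
  also have "\<dots> = C / 2 * norm v" using v by (simp add: power2_eq_square)
  finally show "norm (cofourier f y - cofourier f \<xi> - (\<Sum>l\<in>UNIV. of_real ((y - \<xi>) $ l) * cofourier (?f l) \<xi>)) / norm (y - \<xi>)
      \<le> C / 2 * norm (y - \<xi>)" by (simp add: v_def)
qed simp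

lemma cofourier_schwartz:
  assumes f: "f \<in> smooth_compact"
  shows "cofourier f \<in> schwartz"
proof -
  let ?g = "\<lambda>f l (x::real^'a). \<i> * (of_real (x $ l) * f x)"
  have pd: "partial_deriv l (cofourier f) = cofourier (?g f l)" if "f \<in> smooth_compact" for f :: "real^'a \<Rightarrow> complex" and l
  proof
    fix \<xi>
    have "partial_deriv l (cofourier f) \<xi> = (\<Sum>i\<in>UNIV. of_real (axis l 1 $ i) * cofourier (?g f i) \<xi>)"
      by (rule partial_deriv_eq[OF cofourier_has_derivative[OF that]])
    also have "\<dots> = (\<Sum>i\<in>UNIV. if i = l then cofourier (?g f i) \<xi> else 0)"
      by (intro sum.cong) (auto simp: axis_def)
    finally show "partial_deriv l (cofourier f) \<xi> = cofourier (?g f l) \<xi>" by simp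
  qed
  have gS: "?g f l \<in> smooth_compact" if "f \<in> smooth_compact" for f :: "real^'a \<Rightarrow> complex" and l
    by (intro smooth_compact_scale smooth_compact_coord that)
  have it: "\<exists>h\<in>smooth_compact. iter_partial is (cofourier f) = cofourier h" for "is"
  proof (induction "is")
    case Nil
    show ?case using f by auto
  next
    case (Cons l "is")
    then obtain h where "h \<in> smooth_compact" "iter_partial is (cofourier f) = cofourier h" by blast
    then show ?case using pd[of h l] gS[of h l] by (intro bexI[of _ "?g h l"]) simp_all
  qed
  have "smooth (cofourier f)"
    unfolding smooth_def
  proof (intro allI)
    fix "is" x
    from it obtain h where h: "h \<in> smooth_compact" "iter_partial is (cofourier f) = cofourier h" by blast
    then show "iter_partial is (cofourier f) differentiable at x"
      using cofourier_has_derivative[OF h(1), of x] unfolding differentiable_def h(2) by blast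
  qed
  moreover have "bdd_above (range (\<lambda>x. (1 + norm x) ^ m * norm (iter_partial is (cofourier f) x)))" for m "is"
  proof -
    from it obtain h where h: "h \<in> smooth_compact" "iter_partial is (cofourier f) = cofourier h" by blast
    obtain K where "\<And>\<xi>. (1 + norm \<xi>) ^ m * norm (cofourier h \<xi>) \<le> K"
      using cofourier_rapid_decay[OF h(1)] by blast
    then show ?thesis unfolding h(2) by (rule bdd_aboveI2)
  qed
  ultimately show ?thesis by (simp add: schwartz_def)
qed

definition monomial :: "('n::finite \<Rightarrow> nat) \<Rightarrow> real ^ 'n \<Rightarrow> real" where
  "monomial m \<xi> = (\<Prod>l\<in>UNIV. (\<xi> $ l) ^ m l)"

lemma borel_measurable_monomial [measurable]: "monomial m \<in> borel_measurable borel"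
  unfolding monomial_def[abs_def] by measurable

lemma abs_monomial_le: "\<bar>monomial m \<xi>\<bar> \<le> (1 + norm \<xi>) ^ (\<Sum>l\<in>UNIV. m l)"
  unfolding monomial_def abs_prod power_sum power_abs
  by (intro prod_mono conjI power_mono) (auto intro: order_trans[OF component_le_norm_cart])

text \<open>
  The product of the one-dimensional weights \<open>1 / (1 + \<xi>\<^sub>l\<^sup>2)\<close> is integrable and dominates
  \<open>(1 + norm \<xi>)\<^sup>-\<^sup>2\<^sup>N\<close>.
\<close>

lemma integrable_rapid_decay:
  fixes g :: "real ^ 'n::finite \<Rightarrow> complex"
  assumes g: "g \<in> borel_measurable borel"
    and K: "\<And>\<xi>. (1 + norm \<xi>) ^ (2 * CARD('n)) * norm (g \<xi>) \<le> K"
  shows "integrable lborel g"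
proof -
  have "integrable lborel (\<lambda>u::real. inverse (1 + u\<^sup>2))"
    using integrable_inverse_1_plus_square by (simp add: set_integrable_def)
  then have W: "integrable lborel (\<lambda>\<xi>::real^'n. \<Prod>l\<in>UNIV. inverse (1 + (\<xi> $ l)\<^sup>2))"
    by (rule integrable_lborel_cart_prod)
  have "integrable lborel (\<lambda>\<xi>::real^'n. K * (\<Prod>l\<in>UNIV. inverse (1 + (\<xi> $ l)\<^sup>2)))"
    by (intro integrable_mult_right W)
  then show ?thesis
  proof (rule Bochner_Integration.integrable_bound)
    show "AE \<xi> in lborel. norm (g \<xi>) \<le> norm (K * (\<Prod>l\<in>UNIV. inverse (1 + (\<xi> $ l)\<^sup>2)))"
    proof (rule AE_I2)
      fix \<xi> :: "real ^ 'n"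
      let ?P = "\<Prod>l\<in>UNIV. 1 + (\<xi> $ l)\<^sup>2"
      have "?P \<le> (\<Prod>l\<in>(UNIV::'n set). (1 + norm \<xi>)\<^sup>2)"
      proof (intro prod_mono conjI)
        fix l
        have "(\<xi> $ l)\<^sup>2 \<le> (norm \<xi>)\<^sup>2"
          using power_mono[OF component_le_norm_cart[of \<xi> l] abs_ge_zero, of 2] by simp
        then have "1 + (\<xi> $ l)\<^sup>2 \<le> 1 + (norm \<xi>)\<^sup>2 + 2 * norm \<xi>"
          using norm_ge_zero[of \<xi>] by linarith
        then show "1 + (\<xi> $ l)\<^sup>2 \<le> (1 + norm \<xi>)\<^sup>2" by (simp add: power2_sum)
      qed simp
      also have "\<dots> = (1 + norm \<xi>) ^ (2 * CARD('n))" by (simp add: power_mult)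
      finally have "?P * norm (g \<xi>) \<le> (1 + norm \<xi>) ^ (2 * CARD('n)) * norm (g \<xi>)"
        by (rule mult_right_mono) simp
      also have "\<dots> \<le> K" by (rule K)
      finally have "?P * norm (g \<xi>) \<le> K" .
      moreover have "0 < ?P" by (intro prod_pos ballI) (simp add: add_pos_nonneg)
      ultimately have "norm (g \<xi>) \<le> K * inverse ?P" by (simp add: field_simps)
      then show "norm (g \<xi>) \<le> norm (K * (\<Prod>l\<in>UNIV. inverse (1 + (\<xi> $ l)\<^sup>2)))"
        unfolding prod_inversef[symmetric] o_def by simp
    qed
  qed (use g in simp)
qed

lemma integrable_monomial_cofourier:
  assumes f: "f \<in> smooth_compact"
  shows "integrable lborel (\<lambda>\<xi>. of_real (monomial m \<xi>) * cofourier f \<xi>)"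
proof -
  let ?J = "\<Sum>l\<in>UNIV. m l" and ?p = "2 * CARD('a)"
  obtain K where K: "\<And>\<xi>. (1 + norm \<xi>) ^ (?p + ?J) * norm (cofourier f \<xi>) \<le> K"
    using cofourier_rapid_decay[OF f] by blast
  have [measurable]: "f \<in> borel_measurable borel" using smooth_compact_integrable[OF f] by auto
  show ?thesis
  proof (rule integrable_rapid_decay)
    fix \<xi> :: "real ^ 'a"
    have "(1 + norm \<xi>) ^ ?p * norm (of_real (monomial m \<xi>) * cofourier f \<xi>) =
        (1 + norm \<xi>) ^ ?p * (\<bar>monomial m \<xi>\<bar> * norm (cofourier f \<xi>))" by (simp add: norm_mult)
    also have "\<dots> \<le> (1 + norm \<xi>) ^ ?p * ((1 + norm \<xi>) ^ ?J * norm (cofourier f \<xi>))"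
      by (intro mult_left_mono mult_right_mono abs_monomial_le) auto
    also have "\<dots> \<le> K" using K[of \<xi>] by (simp add: power_add mult.assoc)
    finally show "(1 + norm \<xi>) ^ ?p * norm (of_real (monomial m \<xi>) * cofourier f \<xi>) \<le> K" .
  qed measurable
qed

lemma fourier_cofourier_smooth_compact:
  fixes \<phi> :: "real ^ 'n::finite \<Rightarrow> complex"
  assumes \<phi>: "\<phi> \<in> smooth_compact"
  shows "fourier (cofourier (\<lambda>x. of_real (1 / (2 * pi) ^ CARD('n)) * \<phi> x)) = \<phi>"
proof
  fix y
  let ?c = "complex_of_real (1 / (2 * pi) ^ CARD('n))"
  have c: "(\<lambda>x. ?c * \<phi> x) \<in> smooth_compact" by (rule smooth_compact_scale[OF \<phi>])
  obtain B where B: "\<And>x. norm (?c * \<phi> x) \<le> B" using smooth_compact_bounded[OF c] by blast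
  have "integrable lborel (cofourier (\<lambda>x. ?c * \<phi> x))"
    using integrable_monomial_cofourier[OF c, of "\<lambda>_. 0"] by (simp add: monomial_def)
  moreover have "continuous_on UNIV (\<lambda>x. ?c * \<phi> x)"
    using c by (auto simp: smooth_compact_def smooth_continuous_on)
  ultimately have "fourier (cofourier (\<lambda>x. ?c * \<phi> x)) y = of_real ((2 * pi) ^ CARD('n)) * (?c * \<phi> y)"
    using fourier_cofourier[OF smooth_compact_integrable[OF c] _ B] by blast
  also have "\<dots> = \<phi> y" by simp
  finally show "fourier (cofourier (\<lambda>x. ?c * \<phi> x)) y = \<phi> y" .
qed

section \<open>Heat kernels on the line\<close>

text \<open>
  Over a bounded interval the integral is a difference of values of a primitive \<open>H\<close> of \<open>h\<close>. Moving
  the line changes \<open>H\<close> at either end by at most \<open>\<bar>b\<bar>\<close> times the bound for \<open>h\<close> there, which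
  vanishes in the limit.
\<close>

lemma integral_shift_imaginary:
  fixes h :: "complex \<Rightarrow> complex" and g :: "real \<Rightarrow> real"
  assumes hol: "h holomorphic_on UNIV" and g: "integrable lborel g"
    and g0: "(g \<longlongrightarrow> 0) at_top" "(g \<longlongrightarrow> 0) at_bot"
    and bound: "\<And>\<eta> u. 0 \<le> u \<Longrightarrow> u \<le> 1 \<Longrightarrow> norm (h (Complex \<eta> (u * b))) \<le> g \<eta>"
  shows "(LINT \<eta>|lborel. h (Complex \<eta> b)) = (LINT \<eta>|lborel. h (of_real \<eta>))"
proof -
  obtain H where H: "(H has_field_derivative h z) (at z)" for z
    using holomorphic_convex_primitive'[OF convex_UNIV open_UNIV hol] by auto
  have hc: "continuous_on UNIV h" using hol by (rule holomorphic_on_imp_continuous_on)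
  have lim: "((\<lambda>R. H (Complex R (u*b)) - H (Complex (-R) (u*b))) \<longlongrightarrow> (LINT \<eta>|lborel. h (Complex \<eta> (u*b)))) at_top"
    if u: "0 \<le> u" "u \<le> 1" for u
  proof -
    have cl: "continuous_on A (\<lambda>\<eta>. h (Complex \<eta> (u*b)))" for A
      by (rule continuous_on_compose2[OF hc]) (auto simp: Complex_eq intro!: continuous_intros)
    then have [measurable]: "(\<lambda>\<eta>. h (Complex \<eta> (u*b))) \<in> borel_measurable borel"
      using borel_measurable_continuous_onI by blast
    have "((\<lambda>R. LINT \<eta>|lborel. indicator {-R..R} \<eta> *\<^sub>R h (Complex \<eta> (u*b))) \<longlongrightarrow> (LINT \<eta>|lborel. h (Complex \<eta> (u*b)))) at_top"
    proof (rule integral_dominated_convergence_at_top[OF _ _ g])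
      show "AE x in lborel. ((\<lambda>R. indicator {-R..R} x *\<^sub>R h (Complex x (u*b))) \<longlongrightarrow> h (Complex x (u*b))) at_top"
      proof (rule AE_I2)
        fix x :: real
        have "\<forall>\<^sub>F R in at_top. h (Complex x (u*b)) = indicator {-R..R} x *\<^sub>R h (Complex x (u*b))"
          using eventually_ge_at_top[of "\<bar>x\<bar>"] by eventually_elim (auto simp: indicator_def)
        then show "((\<lambda>R. indicator {-R..R} x *\<^sub>R h (Complex x (u*b))) \<longlongrightarrow> h (Complex x (u*b))) at_top"
          by (rule Lim_transform_eventually[OF tendsto_const])
      qed
      have "norm (indicator {- i..i} x *\<^sub>R h (Complex x (u*b))) \<le> g x" for i x :: real
        using bound[OF u, of x] order_trans[OF norm_ge_zero bound[OF u, of x]]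
        by (cases "x \<in> {-i..i}") auto
      then show "\<forall>\<^sub>F i in at_top. AE x in lborel. norm (indicator {- i..i} x *\<^sub>R h (Complex x (u*b))) \<le> g x"
        by simp
      show "(\<lambda>x. h (Complex x (u*b))) \<in> borel_measurable lborel" by simp
      show "(\<lambda>x. indicator {- i..i} x *\<^sub>R h (Complex x (u*b))) \<in> borel_measurable lborel" for i
        by (intro borel_measurable_scaleR borel_measurable_indicator) auto
    qed
    moreover have "\<forall>\<^sub>F R in at_top. (LINT \<eta>|lborel. indicator {-R..R} \<eta> *\<^sub>R h (Complex \<eta> (u*b))) =
        H (Complex R (u*b)) - H (Complex (-R) (u*b))"
      using eventually_ge_at_top[of "0::real"]
    proof eventually_elim
      case (elim R)
      show ?case
      proof (rule integral_FTC_Icc)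
        fix x
        have "((\<lambda>z. H (z + \<i> * of_real (u*b))) has_field_derivative h (of_real x + \<i> * of_real (u*b)) * 1) (at (of_real x))"
          by (rule DERIV_chain2[OF H]) (auto intro!: derivative_eq_intros)
        from has_vector_derivative_real_field[OF this]
        show "((\<lambda>a. H (Complex a (u*b))) has_vector_derivative h (Complex x (u*b))) (at x within {-R..R})"
          by (simp add: Complex_eq)
      qed (use elim cl in auto)
    qed
    ultimately show ?thesis by (rule Lim_transform_eventually)
  qed
  have side: "norm (H (Complex R b) - H (Complex R 0)) \<le> g R * \<bar>b\<bar>" for R
  proof -
    have "norm (H (Complex R b) - H (Complex R 0)) \<le> g R * norm (Complex R b - Complex R 0)"
    proof (rule field_differentiable_bound[where S="closed_segment (Complex R 0) (Complex R b)" and f'=h])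
      fix z assume "z \<in> closed_segment (Complex R 0) (Complex R b)"
      then obtain u where u: "0 \<le> u" "u \<le> 1" "z = (1 - u) *\<^sub>R Complex R 0 + u *\<^sub>R Complex R b"
        by (auto simp: closed_segment_def)
      then have "z = Complex R (u*b)" by (simp add: complex_eq_iff algebra_simps)
      then show "norm (h z) \<le> g R" using bound u by simp
    qed (auto intro: has_field_derivative_at_within H)
    also have "norm (Complex R b - Complex R 0) = \<bar>b\<bar>" by (simp add: cmod_def)
    finally show ?thesis .
  qed
  have "((\<lambda>R. (H (Complex R b) - H (Complex R 0)) - (H (Complex (-R) b) - H (Complex (-R) 0))) \<longlongrightarrow> 0) at_top"
  proof (rule Lim_null_comparison)
    show "\<forall>\<^sub>F R in at_top. norm ((H (Complex R b) - H (Complex R 0)) - (H (Complex (-R) b) - H (Complex (-R) 0)))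
        \<le> g R * \<bar>b\<bar> + g (-R) * \<bar>b\<bar>"
      by (intro always_eventually allI order_trans[OF norm_triangle_ineq4] add_mono side)
    have "((\<lambda>R. g (-R)) \<longlongrightarrow> 0) at_top"
      using g0(2) by (simp add: filterlim_at_bot_mirror)
    then show "((\<lambda>R. g R * \<bar>b\<bar> + g (-R) * \<bar>b\<bar>) \<longlongrightarrow> 0) at_top"
      using tendsto_add[OF tendsto_mult_left_zero[OF g0(1)] tendsto_mult_left_zero] by fastforce
  qed
  moreover have "((\<lambda>R. (H (Complex R b) - H (Complex R 0)) - (H (Complex (-R) b) - H (Complex (-R) 0)))
      \<longlongrightarrow> (LINT \<eta>|lborel. h (Complex \<eta> b)) - (LINT \<eta>|lborel. h (Complex \<eta> 0))) at_top"
    using tendsto_diff[OF lim[of 1] lim[of 0]] by (simp add: algebra_simps)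
  ultimately have "(LINT \<eta>|lborel. h (Complex \<eta> b)) - (LINT \<eta>|lborel. h (Complex \<eta> 0)) = 0"
    using tendsto_unique trivial_limit_at_top_linorder by blast
  then show ?thesis by (simp add: Complex_eq)
qed

text \<open>
  The common majorant of all the rescaled one-dimensional symbols, on the real line and on the shifted
  lines alike.
\<close>

definition gauss_weight :: "nat \<Rightarrow> real \<Rightarrow> real" where
  "gauss_weight j u = (\<bar>u\<bar> + 1) ^ j * exp (- u\<^sup>2)"

lemma gauss_weight_nonneg: "0 \<le> gauss_weight j u"
  by (simp add: gauss_weight_def)

lemma borel_measurable_gauss_weight [measurable]: "gauss_weight j \<in> borel_measurable borel"
  unfolding gauss_weight_def[abs_def] by measurable

lemma integrable_gauss_weight: "integrable lborel (gauss_weight j)"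
proof -
  \<comment> \<open>Splitting at \<open>\<bar>u\<bar> = 1\<close> bounds the weight by absolute moments of the normal density.\<close>
  define D where "D u = 2 ^ j * sqrt (2 * pi) * (std_normal_density u * \<bar>u\<bar> ^ j + std_normal_density u * \<bar>u\<bar> ^ 0)" for u
  have "integrable lborel D" unfolding D_def
    by (intro integrable_mult_right Bochner_Integration.integrable_add integrable_std_normal_moment_abs)
  then show ?thesis
  proof (rule Bochner_Integration.integrable_bound)
    show "AE u in lborel. norm (gauss_weight j u) \<le> norm (D u)"
    proof (rule AE_I2)
      fix u :: real
      have *: "(\<bar>u\<bar> + 1) ^ j \<le> 2 ^ j * (\<bar>u\<bar> ^ j + 1)"
      proof (cases "\<bar>u\<bar> \<le> 1")
        case True
        then have "(\<bar>u\<bar> + 1) ^ j \<le> 2 ^ j" by (intro power_mono) auto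
        also have "\<dots> \<le> 2 ^ j * (\<bar>u\<bar> ^ j + 1)" by simp
        finally show ?thesis .
      next
        case False
        then have "(\<bar>u\<bar> + 1) ^ j \<le> (2 * \<bar>u\<bar>) ^ j" by (intro power_mono) auto
        also have "\<dots> \<le> 2 ^ j * (\<bar>u\<bar> ^ j + 1)" by (simp add: power_mult_distrib)
        finally show ?thesis .
      qed
      have "gauss_weight j u \<le> 2 ^ j * (\<bar>u\<bar> ^ j + 1) * exp (- u\<^sup>2 / 2)"
        unfolding gauss_weight_def by (intro mult_mono *) auto
      also have "\<dots> = D u" by (simp add: D_def std_normal_density_def field_simps)
      finally show "norm (gauss_weight j u) \<le> norm (D u)"
        using gauss_weight_nonneg[of j u] by simp
    qed
  qed simp
qed

lemma gauss_weight_tendsto_0: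
  "(gauss_weight j \<longlongrightarrow> 0) at_top" "(gauss_weight j \<longlongrightarrow> 0) at_bot"
proof -
  have "((\<lambda>u::real. (u + 1) ^ j * exp (- u\<^sup>2)) \<longlongrightarrow> 0) at_top" by real_asymp
  moreover have "\<forall>\<^sub>F u in at_top. (u + 1) ^ j * exp (- u\<^sup>2) = gauss_weight j u"
    using eventually_ge_at_top[of "0::real"] by eventually_elim (simp add: gauss_weight_def)
  ultimately show *: "(gauss_weight j \<longlongrightarrow> 0) at_top" by (rule Lim_transform_eventually)
  have "gauss_weight j (- u) = gauss_weight j u" for u by (simp add: gauss_weight_def)
  with * show "(gauss_weight j \<longlongrightarrow> 0) at_bot" by (simp add: filterlim_at_bot_mirror)
qed

lemma scaled_gauss_weight:
  assumes "0 < t"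
  shows "integrable lborel (\<lambda>\<eta>. gauss_weight j (sqrt t * \<eta>))"
    and "(LINT \<eta>|lborel. gauss_weight j (sqrt t * \<eta>)) = (LINT u|lborel. gauss_weight j u) / sqrt t"
  using assms lborel_integrable_real_affine[OF integrable_gauss_weight, of "sqrt t" j 0]
    lborel_integral_real_affine[of "sqrt t" "gauss_weight j" 0]
  by (auto simp: field_simps)

text \<open>
  The parameter \<open>\<epsilon>\<close> is \<open>1\<close> for the distinguished coordinate, which carries the quartic term, and \<open>0\<close>
  for the others; the estimates are uniform in \<open>\<epsilon>\<close>.
\<close>

definition heat_symbol :: "real \<Rightarrow> real \<Rightarrow> nat \<Rightarrow> complex \<Rightarrow> complex" where
  "heat_symbol t \<epsilon> j z = z ^ j * exp (- (of_real t * (z\<^sup>2 + of_real \<epsilon> * z ^ 4)))"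

definition heat_kernel :: "real \<Rightarrow> real \<Rightarrow> nat \<Rightarrow> real \<Rightarrow> complex" where
  "heat_kernel t \<epsilon> j s = (LINT \<eta>|lborel. heat_symbol t \<epsilon> j (of_real \<eta>) * cis (\<eta> * s))"

text \<open>
  On the line with imaginary part \<open>b\<close> the quadratic part of the exponent loses \<open>t b\<^sup>2 \<le> 1\<close>. For the
  quartic part, completing the square gives \<open>Re (\<eta> + \<i> b)\<^sup>4 \<ge> - 8 b\<^sup>4\<close>, hence a loss of at most \<open>8\<close>.
  Together this is the factor \<open>exp 9\<close>.
\<close>

lemma heat_symbol_bound:
  assumes t: "0 < t" and e: "0 \<le> \<epsilon>" "\<epsilon> \<le> 1"
    and b: "\<bar>b\<bar> * sqrt t \<le> 1" "t * b ^ 4 \<le> 1"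
  shows "norm (heat_symbol t \<epsilon> j (Complex \<eta> b)) \<le> exp 9 * (1 / sqrt t) ^ j * gauss_weight j (sqrt t * \<eta>)"
proof -
  let ?z = "Complex \<eta> b"
  have st: "sqrt t > 0" "(sqrt t)\<^sup>2 = t" using t by auto
  have b2: "t * b\<^sup>2 \<le> 1"
  proof -
    have "(\<bar>b\<bar> * sqrt t)\<^sup>2 \<le> 1\<^sup>2" using b(1) st by (intro power_mono) auto
    then show ?thesis using st by (simp add: power_mult_distrib mult.commute)
  qed
  have z2: "Re (?z\<^sup>2) = \<eta>\<^sup>2 - b\<^sup>2" by (simp add: power2_eq_square)
  have z4: "Re (?z ^ 4) = \<eta> ^ 4 - 6 * \<eta>\<^sup>2 * b\<^sup>2 + b ^ 4"
    by (simp add: power2_eq_square power4_eq_xxxx algebra_simps)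
  have low: "- 8 * b ^ 4 \<le> \<eta> ^ 4 - 6 * \<eta>\<^sup>2 * b\<^sup>2 + b ^ 4"
  proof -
    have "0 \<le> (\<eta>\<^sup>2 - 3 * b\<^sup>2)\<^sup>2" by simp
    then show ?thesis by (simp add: power2_eq_square power4_eq_xxxx algebra_simps)
  qed
  have "t * \<epsilon> * (- 8 * b ^ 4) \<le> t * \<epsilon> * (\<eta> ^ 4 - 6 * \<eta>\<^sup>2 * b\<^sup>2 + b ^ 4)"
    using low t e by (intro mult_left_mono) auto
  moreover have "t * \<epsilon> * (8 * b ^ 4) \<le> 8"
  proof -
    have "\<epsilon> * (t * b ^ 4) \<le> 1 * 1" using b(2) e t by (intro mult_mono) auto
    then show ?thesis by (simp add: mult_ac)
  qed
  ultimately have "Re (- (of_real t * (?z\<^sup>2 + of_real \<epsilon> * ?z ^ 4))) \<le> 9 - t * \<eta>\<^sup>2"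
    using b2 by (simp add: z2 z4 algebra_simps)
  then have 1: "norm (exp (- (of_real t * (?z\<^sup>2 + of_real \<epsilon> * ?z ^ 4)))) \<le> exp (9 - t * \<eta>\<^sup>2)"
    by (simp only: norm_exp_eq_Re exp_le_cancel_iff)
  have "norm ?z \<le> \<bar>\<eta>\<bar> + \<bar>b\<bar>" using complex_norm_square cmod_le[of ?z] by simp
  also have "\<dots> \<le> \<bar>\<eta>\<bar> + 1 / sqrt t" using b(1) st by (simp add: field_simps)
  also have "\<dots> = 1 / sqrt t * (\<bar>sqrt t * \<eta>\<bar> + 1)" using st by (simp add: field_simps abs_mult)
  finally have "norm ?z ^ j \<le> (1 / sqrt t * (\<bar>sqrt t * \<eta>\<bar> + 1)) ^ j" by (intro power_mono) auto
  then have "norm (heat_symbol t \<epsilon> j ?z) \<le> (1 / sqrt t * (\<bar>sqrt t * \<eta>\<bar> + 1)) ^ j * exp (9 - t * \<eta>\<^sup>2)"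
    unfolding heat_symbol_def norm_mult norm_power using st by (intro mult_mono 1) auto
  also have "\<dots> = exp 9 * (1 / sqrt t) ^ j * gauss_weight j (sqrt t * \<eta>)"
    using t by (simp add: gauss_weight_def power_mult_distrib exp_diff exp_minus field_simps)
  finally show ?thesis .
qed

lemma heat_symbol_real:
  assumes t: "0 < t" and e: "0 \<le> \<epsilon>" "\<epsilon> \<le> 1"
  shows "integrable lborel (\<lambda>\<eta>. heat_symbol t \<epsilon> j (of_real \<eta>))"
    and "(LINT \<eta>|lborel. norm (heat_symbol t \<epsilon> j (of_real \<eta>))) \<le>
           exp 9 * (LINT u|lborel. gauss_weight j u) * (1 / sqrt t) ^ (j + 1)"
proof -
  have b: "norm (heat_symbol t \<epsilon> j (of_real \<eta>)) \<le> exp 9 * (1 / sqrt t) ^ j * gauss_weight j (sqrt t * \<eta>)" for \<eta>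
    using heat_symbol_bound[OF t e, of 0 j \<eta>] by (simp add: complex_of_real_def)
  have i: "integrable lborel (\<lambda>\<eta>. exp 9 * (1 / sqrt t) ^ j * gauss_weight j (sqrt t * \<eta>))"
    by (intro integrable_mult_right scaled_gauss_weight t)
  show I: "integrable lborel (\<lambda>\<eta>. heat_symbol t \<epsilon> j (of_real \<eta>))"
  proof (rule Bochner_Integration.integrable_bound[OF i])
    show "(\<lambda>\<eta>. heat_symbol t \<epsilon> j (of_real \<eta>)) \<in> borel_measurable lborel"
      unfolding heat_symbol_def by measurable
  qed (auto intro!: AE_I2 order_trans[OF b] simp del: abs_mult)
  have "(LINT \<eta>|lborel. norm (heat_symbol t \<epsilon> j (of_real \<eta>))) \<le>
        (LINT \<eta>|lborel. exp 9 * (1 / sqrt t) ^ j * gauss_weight j (sqrt t * \<eta>))"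
    by (intro integral_mono integrable_norm I i b)
  also have "\<dots> = exp 9 * (LINT u|lborel. gauss_weight j u) * (1 / sqrt t) ^ (j + 1)"
    using t by (simp add: scaled_gauss_weight)
  finally show "(LINT \<eta>|lborel. norm (heat_symbol t \<epsilon> j (of_real \<eta>))) \<le>
           exp 9 * (LINT u|lborel. gauss_weight j u) * (1 / sqrt t) ^ (j + 1)" .
qed

text \<open>
  The line is moved by \<open>a\<close> towards the half-plane, depending on the sign of \<open>s\<close>, where
  \<open>exp (\<i> z s)\<close> decays.
\<close>

lemma heat_kernel_bound:
  assumes t: "0 < t" and e: "0 \<le> \<epsilon>" "\<epsilon> \<le> 1"
    and a: "0 \<le> a" "a * sqrt t \<le> 1" "t * a ^ 4 \<le> 1"
  shows "norm (heat_kernel t \<epsilon> j s) \<le>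
    exp 9 * (LINT u|lborel. gauss_weight j u) * (1 / sqrt t) ^ (j + 1) * exp (- (a * \<bar>s\<bar>))"
proof -
  \<comment> \<open>With this sign the shifted phase is \<open>exp (- a \<bar>s\<bar>)\<close>.\<close>
  define b where "b = (if 0 \<le> s then a else - a)"
  define h where "h z = heat_symbol t \<epsilon> j z * exp (\<i> * z * of_real s)" for z
  define g where "g \<eta> = exp 9 * (1 / sqrt t) ^ j * gauss_weight j (sqrt t * \<eta>)" for \<eta>
  have sq: "sqrt t > 0" using t by simp
  have g_nn: "0 \<le> g \<eta>" for \<eta> using sq by (simp add: g_def gauss_weight_nonneg)
  have bs: "b * s = a * \<bar>s\<bar>" by (simp add: b_def)
  have hb: "norm (h (Complex \<eta> (u * b))) \<le> g \<eta> * exp (- (u * (a * \<bar>s\<bar>)))"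
    if u: "0 \<le> u" "u \<le> 1" for \<eta> u
  proof -
    have ua: "\<bar>u * b\<bar> \<le> a" "\<bar>u * b\<bar> = u * a" using u a by (auto simp: b_def abs_mult mult_left_le_one_le)
    have "\<bar>u * b\<bar> * sqrt t \<le> a * sqrt t" using ua sq by (intro mult_right_mono) auto
    moreover have "t * (u * b) ^ 4 \<le> t * a ^ 4"
    proof (intro mult_left_mono)
      have "\<bar>u * b\<bar> ^ 4 \<le> a ^ 4" using ua(1) by (intro power_mono) auto
      then show "(u * b) ^ 4 \<le> a ^ 4" by (simp only: power_even_abs_numeral even_numeral)
    qed (use t in auto)
    ultimately have "norm (heat_symbol t \<epsilon> j (Complex \<eta> (u * b))) \<le> g \<eta>"
      unfolding g_def using a by (intro heat_symbol_bound t e) auto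
    moreover have "norm (exp (\<i> * Complex \<eta> (u * b) * of_real s)) \<le> exp (- (u * (a * \<bar>s\<bar>)))"
    proof -
      have "Re (\<i> * Complex \<eta> (u * b) * of_real s) = - (u * (b * s))" by simp
      then show ?thesis by (simp only: norm_exp_eq_Re bs order_refl)
    qed
    ultimately show ?thesis
      unfolding h_def norm_mult by (rule mult_mono[OF _ _ g_nn norm_ge_zero])
  qed
  have gi: "integrable lborel g" unfolding g_def
    by (intro integrable_mult_right scaled_gauss_weight t)
  have g_lim: "(g \<longlongrightarrow> 0) at_top" "(g \<longlongrightarrow> 0) at_bot"
    unfolding g_def
    by (intro tendsto_mult_right_zero filterlim_compose[OF gauss_weight_tendsto_0(1)]
          filterlim_tendsto_pos_mult_at_top[OF tendsto_const sq filterlim_ident],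
        intro tendsto_mult_right_zero filterlim_compose[OF gauss_weight_tendsto_0(2)]
          filterlim_tendsto_pos_mult_at_bot[OF tendsto_const sq filterlim_ident])
  have "heat_kernel t \<epsilon> j s = (LINT \<eta>|lborel. h (of_real \<eta>))"
    by (simp add: heat_kernel_def h_def cis_conv_exp mult_ac)
  also have "\<dots> = (LINT \<eta>|lborel. h (Complex \<eta> b))"
  proof (rule integral_shift_imaginary[OF _ gi g_lim, symmetric])
    show "h holomorphic_on UNIV" unfolding h_def heat_symbol_def by (intro holomorphic_intros)
    fix \<eta> u :: real assume u: "0 \<le> u" "u \<le> 1"
    have "g \<eta> * exp (- (u * (a * \<bar>s\<bar>))) \<le> g \<eta> * 1"
      using u a by (intro mult_left_mono g_nn) auto
    then show "norm (h (Complex \<eta> (u * b))) \<le> g \<eta>" using hb[OF u, of \<eta>] by simp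
  qed
  also have "norm \<dots> \<le> (LINT \<eta>|lborel. g \<eta> * exp (- (a * \<bar>s\<bar>)))"
    by (rule norm_integral_le_dominating) (use hb[of 1] gi in auto)
  also have "\<dots> = exp 9 * (LINT u|lborel. gauss_weight j u) * (1 / sqrt t) ^ (j + 1) * exp (- (a * \<bar>s\<bar>))"
    using t by (simp add: g_def scaled_gauss_weight)
  finally show ?thesis .
qed

section \<open>Heat kernels in several variables\<close>

text \<open>
  The heat kernel at time \<open>t\<close> is of size \<open>t\<^sup>-\<^sup>n\<^sup>/\<^sup>2\<close>, where \<open>n\<close> is this number, and the kernel
  decays like \<open>|x|\<^sup>2\<^sup>-\<^sup>n\<close>.
\<close>

definition kernel_order :: "('n::finite \<Rightarrow> nat) \<Rightarrow> nat" where
  "kernel_order m = CARD('n) + (\<Sum>l\<in>UNIV. m l)"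

definition quartic :: "'n::finite \<Rightarrow> real ^ 'n \<Rightarrow> real" where
  "quartic i \<xi> = (norm \<xi>)\<^sup>2 + (\<xi> $ i) ^ 4"

definition heat_multiplier :: "'n::finite \<Rightarrow> ('n \<Rightarrow> nat) \<Rightarrow> real \<Rightarrow> real ^ 'n \<Rightarrow> complex" where
  "heat_multiplier i m t \<xi> = of_real (monomial m \<xi> * exp (- (t * quartic i \<xi>)))"

lemma heat_multiplier_prod:
  "heat_multiplier i m t \<xi> =
    (\<Prod>l\<in>UNIV. heat_symbol t (if l = i then 1 else 0) (m l) (of_real (\<xi> $ l)))"
proof -
  have "quartic i \<xi> = (\<Sum>l\<in>UNIV. (\<xi> $ l)\<^sup>2 + (if l = i then 1 else 0) * (\<xi> $ l) ^ 4)"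
  proof -
    have "(norm \<xi>)\<^sup>2 = (\<Sum>l\<in>UNIV. (\<xi> $ l)\<^sup>2)"
      by (simp only: power2_norm_eq_inner inner_vec_def) (simp add: power2_eq_square)
    then show ?thesis
      by (simp add: quartic_def sum.distrib if_distrib[of "\<lambda>x. x * _"] sum.delta cong: if_cong)
  qed
  then have "exp (- (t * quartic i \<xi>)) =
      (\<Prod>l\<in>UNIV. exp (- (t * ((\<xi> $ l)\<^sup>2 + (if l = i then 1 else 0) * (\<xi> $ l) ^ 4))))"
    by (simp add: exp_sum[symmetric] sum_negf sum_distrib_left)
  then have "monomial m \<xi> * exp (- (t * quartic i \<xi>)) =
      (\<Prod>l\<in>UNIV. (\<xi> $ l) ^ m l * exp (- (t * ((\<xi> $ l)\<^sup>2 + (if l = i then 1 else 0) * (\<xi> $ l) ^ 4))))"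
    by (simp add: monomial_def prod.distrib)
  then have "heat_multiplier i m t \<xi> = (\<Prod>l\<in>UNIV. of_real ((\<xi> $ l) ^ m l * exp (- (t * ((\<xi> $ l)\<^sup>2 + (if l = i then 1 else 0) * (\<xi> $ l) ^ 4)))))"
    unfolding heat_multiplier_def by (simp only: of_real_prod)
  also have "\<dots> = (\<Prod>l\<in>UNIV. heat_symbol t (if l = i then 1 else 0) (m l) (of_real (\<xi> $ l)))"
    by (intro prod.cong refl) (simp add: heat_symbol_def exp_of_real[symmetric])
  finally show ?thesis .
qed

lemma cofourier_heat_multiplier:
  assumes "0 < t"
  shows "cofourier (heat_multiplier i m t) x =
    (\<Prod>l\<in>UNIV. heat_kernel t (if l = i then 1 else 0) (m l) (x $ l))"
proof -
  let ?h = "\<lambda>l \<eta>. heat_symbol t (if l = i then 1 else 0) (m l) (of_real \<eta>) * cis (\<eta> * x $ l)"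
  have "integrable lborel (?h l)" for l
    by (intro integrable_mult_cis heat_symbol_real assms) auto
  from integral_lborel_cart_prod[of ?h, OF this] show ?thesis
    by (simp add: cofourier_def heat_multiplier_prod heat_kernel_def inner_vec_def cis_sum prod.distrib)
qed

definition heat_const :: "('n::finite \<Rightarrow> nat) \<Rightarrow> real" where
  "heat_const m = (\<Prod>l\<in>UNIV. exp 9 * (LINT u|lborel. gauss_weight (m l) u))"

lemma heat_const_nonneg: "0 \<le> heat_const m"
  unfolding heat_const_def
  by (intro prod_nonneg ballI mult_nonneg_nonneg integral_nonneg) (auto simp: gauss_weight_nonneg)

lemma heat_const_prod:
  "(\<Prod>l\<in>UNIV. exp 9 * (LINT u|lborel. gauss_weight (m l) u) * q ^ (m l + 1)) =
     heat_const m * q ^ kernel_order m" for q :: real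
  by (simp add: heat_const_def kernel_order_def prod.distrib power_add power_sum mult_ac)

lemma heat_multiplier_L1:
  assumes "0 < t"
  shows "integrable lborel (heat_multiplier i m t)"
    and "(LINT \<xi>|lborel. norm (heat_multiplier i m t \<xi>)) \<le> heat_const m * (1 / sqrt t) ^ kernel_order m"
proof -
  let ?h = "\<lambda>l \<eta>. heat_symbol t (if l = i then 1 else 0) (m l) (of_real \<eta>)"
  have h: "integrable lborel (?h l)" for l
    by (intro heat_symbol_real assms) auto
  from integrable_lborel_cart_prod[of ?h, OF this]
  show "integrable lborel (heat_multiplier i m t)"
    by (simp add: heat_multiplier_prod[abs_def])
  have "(LINT \<xi>|lborel. norm (heat_multiplier i m t \<xi>)) = (\<Prod>l\<in>UNIV. LINT \<eta>|lborel. norm (?h l \<eta>))"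
    unfolding heat_multiplier_prod prod_norm[symmetric]
    by (rule integral_lborel_cart_prod) (intro integrable_norm h)
  also have "\<dots> \<le> (\<Prod>l\<in>UNIV. exp 9 * (LINT u|lborel. gauss_weight (m l) u) * (1 / sqrt t) ^ (m l + 1))"
    by (intro prod_mono conjI heat_symbol_real(2) assms integral_nonneg) auto
  also have "\<dots> = heat_const m * (1 / sqrt t) ^ kernel_order m" by (rule heat_const_prod)
  finally show "(LINT \<xi>|lborel. norm (heat_multiplier i m t \<xi>)) \<le> heat_const m * (1 / sqrt t) ^ kernel_order m" .
qed

lemma cofourier_heat_multiplier_exp_bound:
  assumes t: "0 < t" and a: "0 \<le> a" "a * sqrt t \<le> 1" "t * a ^ 4 \<le> 1"
  shows "norm (cofourier (heat_multiplier i m t) x) \<le>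
    heat_const m * (1 / sqrt t) ^ kernel_order m * exp (- (a * norm x))"
proof -
  have "norm (cofourier (heat_multiplier i m t) x) \<le>
    (\<Prod>l\<in>UNIV. exp 9 * (LINT u|lborel. gauss_weight (m l) u) * (1 / sqrt t) ^ (m l + 1) * exp (- (a * \<bar>x $ l\<bar>)))"
    unfolding cofourier_heat_multiplier[OF t] prod_norm[symmetric]
    by (intro prod_mono conjI heat_kernel_bound t a) auto
  also have "\<dots> = heat_const m * (1 / sqrt t) ^ kernel_order m * (\<Prod>l\<in>UNIV. exp (- (a * \<bar>x $ l\<bar>)))"
    by (subst prod.distrib) (simp only: heat_const_prod)
  also have "(\<Prod>l\<in>UNIV. exp (- (a * \<bar>x $ l\<bar>))) = exp (- (a * (\<Sum>l\<in>UNIV. \<bar>x $ l\<bar>)))"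
    by (simp add: exp_sum[symmetric] sum_negf sum_distrib_left)
  also have "\<dots> \<le> exp (- (a * norm x))"
    using mult_left_mono[OF norm_le_l1_cart[of x] a(1)] by simp
  finally show ?thesis using heat_const_nonneg[of m] t by (simp add: mult_left_mono)
qed

lemma power_le_fact_exp:
  assumes "0 \<le> (u::real)"
  shows "u ^ k \<le> fact k * exp u"
proof -
  have "(\<Sum>n\<in>{k}. u ^ n /\<^sub>R fact n) \<le> (\<Sum>n. u ^ n /\<^sub>R fact n)"
    using assms by (intro sum_le_suminf summable_exp_generic) auto
  then have "u ^ k / fact k \<le> exp u" by (simp add: exp_def divide_inverse mult.commute)
  then show ?thesis by (simp add: field_simps)
qed

lemma mult_exp_minus_le: "A \<le> B * exp u \<Longrightarrow> A * exp (- u) \<le> B" for A B u :: real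
  by (simp add: exp_minus field_simps)

definition kernel_const :: "('n::finite \<Rightarrow> nat) \<Rightarrow> real" where
  "kernel_const m = heat_const m * fact (2 * kernel_order m) * sqrt 2 ^ kernel_order m"

lemma kernel_const_nonneg: "0 \<le> kernel_const m"
  by (simp add: kernel_const_def heat_const_nonneg)

text \<open>
  Since \<open>|x|\<^sup>2 + t\<close> is at most twice the square of \<open>max |x| (sqrt t)\<close>, it suffices to bound the
  \<open>n\<close>-th power of this maximum times the heat kernel. If \<open>sqrt t\<close> is the larger one, no shift is needed.
  Otherwise the exponential with \<open>a = t\<^sup>-\<^sup>1\<^sup>/\<^sup>2\<close> (for \<open>t \<ge> 1\<close>) absorbs \<open>n\<close> powers of
  \<open>|x| / sqrt t\<close>. For \<open>t < 1\<close> the largest admissible value is \<open>a = t\<^sup>-\<^sup>1\<^sup>/\<^sup>4\<close>; its exponential absorbs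
  \<open>2 n\<close> powers of \<open>|x| / t\<^sup>1\<^sup>/\<^sup>4\<close>, that is \<open>n\<close> powers of \<open>|x|\<^sup>2 / sqrt t\<close>, and
  \<open>|x|\<^sup>2 \<ge> |x|\<close> because \<open>|x| \<ge> 1\<close>.
\<close>

lemma cofourier_heat_multiplier_decay:
  assumes t: "0 < t" and x: "1 \<le> norm x"
  shows "norm (cofourier (heat_multiplier i m t) x) \<le>
    kernel_const m * ((norm x)\<^sup>2 + t) powr (- (real (kernel_order m) / 2))"
proof -
  let ?n = "kernel_order m" and ?k = "norm (cofourier (heat_multiplier i m t) x)" and ?C = "heat_const m"
  define r where "r = norm x"
  have r: "1 \<le> r" using x by (simp add: r_def)
  have C: "0 \<le> ?C" by (rule heat_const_nonneg)
  have q: "sqrt t > 0" using t by simp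
  define F where "F = (fact (2 * ?n) :: real)"
  have F1: "1 \<le> F" unfolding F_def by (rule fact_ge_1)
  have Fn: "fact ?n \<le> F" unfolding F_def by (rule fact_mono) simp
  \<comment> \<open>The factorial serves both exponential bounds below, since \<open>n! \<le> (2 n)!\<close>.\<close>
  have max: "max r (sqrt t) ^ ?n * ?k \<le> ?C * F"
  proof (cases "r \<le> sqrt t")
    case True
    have "max r (sqrt t) ^ ?n * ?k \<le> sqrt t ^ ?n * (?C * (1 / sqrt t) ^ ?n * exp (- (0 * norm x)))"
      using True q by (intro mult_mono cofourier_heat_multiplier_exp_bound t) auto
    also have "\<dots> = ?C * 1" using q by (simp add: power_divide)
    also have "\<dots> \<le> ?C * F" by (intro mult_left_mono F1 C)
    finally show ?thesis .
  next
    case False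
    show ?thesis
    proof (cases "1 \<le> t")
      case True
      have "1 \<le> t\<^sup>2" using True by simp
      then have "t * (1 / sqrt t) ^ 4 \<le> 1"
        using True t by (simp add: power_divide power4_eq_xxxx field_simps power2_eq_square)
      then have "max r (sqrt t) ^ ?n * ?k \<le> r ^ ?n * (?C * (1 / sqrt t) ^ ?n * exp (- (1 / sqrt t * norm x)))"
        using False q r by (intro mult_mono cofourier_heat_multiplier_exp_bound t) auto
      also have "\<dots> = ?C * ((r / sqrt t) ^ ?n * exp (- (r / sqrt t)))"
        by (simp add: r_def power_divide)
      also have "(r / sqrt t) ^ ?n * exp (- (r / sqrt t)) \<le> F"
      proof -
        have "(r / sqrt t) ^ ?n \<le> fact ?n * exp (r / sqrt t)"
          using r q by (intro power_le_fact_exp) auto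
        also have "\<dots> \<le> F * exp (r / sqrt t)" using Fn by simp
        finally show ?thesis by (rule mult_exp_minus_le)
      qed
      finally show ?thesis using C by (simp add: mult_left_mono)
    next
      case False': False
      define s where "s = sqrt (sqrt t)"
      have s: "0 < s" "s\<^sup>2 = sqrt t" using t by (auto simp: s_def)
      have s4: "t = s ^ 4"
        using t s(2) power_mult[of s 2 2] by simp
      have "s \<le> 1" using False' by (simp add: s_def)
      then have "1 / s * sqrt t \<le> 1"
        using s(1) unfolding s(2)[symmetric] by (simp add: power2_eq_square)
      moreover have "t * (1 / s) ^ 4 \<le> 1"
        using s(1) unfolding s4 by (simp add: power_divide)
      ultimately have "max r (sqrt t) ^ ?n * ?k \<le> r ^ ?n * (?C * (1 / sqrt t) ^ ?n * exp (- (1 / s * norm x)))"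
        using False q r s by (intro mult_mono cofourier_heat_multiplier_exp_bound t) auto
      also have "\<dots> = ?C * ((r / sqrt t) ^ ?n * exp (- (r / s)))"
        by (simp add: r_def power_divide)
      also have "(r / sqrt t) ^ ?n * exp (- (r / s)) \<le> F"
      proof -
        have "r / sqrt t \<le> (r / s)\<^sup>2"
          using r s by (simp add: power_divide s(2)[symmetric] divide_right_mono power2_eq_square)
        then have "(r / sqrt t) ^ ?n \<le> ((r / s)\<^sup>2) ^ ?n"
          using r q by (intro power_mono) auto
        also have "\<dots> = (r / s) ^ (2 * ?n)" by (simp add: power_mult)
        also have "\<dots> \<le> F * exp (r / s)"
          unfolding F_def using r s by (intro power_le_fact_exp) auto
        finally show ?thesis by (rule mult_exp_minus_le)
      qed
      finally show ?thesis using C by (simp add: mult_left_mono)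
    qed
  qed
  have rt: "0 < r\<^sup>2 + t" using r t by (intro add_pos_pos) auto
  have "r\<^sup>2 + t \<le> 2 * (max r (sqrt t))\<^sup>2"
  proof -
    have "r\<^sup>2 \<le> (max r (sqrt t))\<^sup>2" "(sqrt t)\<^sup>2 \<le> (max r (sqrt t))\<^sup>2"
      using r q by (auto intro!: power_mono simp del: real_sqrt_pow2)
    moreover have "(sqrt t)\<^sup>2 = t" using t by simp
    ultimately show ?thesis by linarith
  qed
  then have "sqrt (r\<^sup>2 + t) \<le> sqrt (2 * (max r (sqrt t))\<^sup>2)" by (rule real_sqrt_le_mono)
  also have "\<dots> = sqrt 2 * max r (sqrt t)" using r by (simp add: real_sqrt_mult)
  finally have "sqrt (r\<^sup>2 + t) ^ ?n \<le> (sqrt 2 * max r (sqrt t)) ^ ?n"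
    using rt by (intro power_mono) auto
  then have "sqrt (r\<^sup>2 + t) ^ ?n * ?k \<le> (sqrt 2 * max r (sqrt t)) ^ ?n * ?k"
    by (rule mult_right_mono) simp
  also have "\<dots> = sqrt 2 ^ ?n * (max r (sqrt t) ^ ?n * ?k)" by (simp add: power_mult_distrib)
  also have "\<dots> \<le> sqrt 2 ^ ?n * (?C * F)" by (intro mult_left_mono max) auto
  also have "\<dots> = kernel_const m" by (simp add: kernel_const_def F_def)
  finally have "sqrt (r\<^sup>2 + t) ^ ?n * ?k \<le> kernel_const m" .
  moreover have "sqrt (r\<^sup>2 + t) ^ ?n = (r\<^sup>2 + t) powr (real ?n / 2)"
    using rt by (simp add: powr_half_sqrt[symmetric] powr_powr flip: powr_realpow)
  ultimately show ?thesis using rt by (simp add: powr_minus field_simps r_def)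
qed

section \<open>The kernel as an integral over time\<close>

text \<open>
  The weight has an explicit antiderivative in \<open>t\<close>. With \<open>b = n / 2\<close> the exponent \<open>2 - 2 b\<close> is the decay
  rate of the kernel, and \<open>b > 1\<close> is the condition \<open>n \<ge> 3\<close>.
\<close>

lemma time_weight:
  fixes r b :: real
  assumes r: "0 < r" and b: "1 < b"
  shows "integrable lborel (\<lambda>t. indicator {0<..} t * (r\<^sup>2 + t) powr (- b))"
    and "(LINT t|lborel. indicator {0<..} t * (r\<^sup>2 + t) powr (- b)) \<le> r powr (2 - 2 * b) / (b - 1)"
proof -
  let ?f = "\<lambda>t. (r\<^sup>2 + t) powr (- b)"
  let ?F = "\<lambda>t. - ((r\<^sup>2 + t) powr (1 - b) / (b - 1))"
  have pos: "0 < r\<^sup>2 + t" if "0 \<le> t" for t using r that by (intro add_pos_nonneg) auto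
  have nn: "(\<integral>\<^sup>+t. ennreal (?f t) * indicator {0 ..} t \<partial>lborel) = 0 - ?F 0"
  proof (rule nn_integral_FTC_atLeast)
    fix t :: real assume t: "0 \<le> t"
    show "(?F has_real_derivative ?f t) (at t)"
    proof -
      have "((\<lambda>t. (r\<^sup>2 + t) powr (1 - b)) has_real_derivative (1 - b) * (r\<^sup>2 + t) powr (1 - b - 1) * 1) (at t)"
        by (rule DERIV_chain2[where g="\<lambda>t. r\<^sup>2 + t", OF has_real_derivative_powr[OF pos[OF t]]]) (auto intro!: derivative_eq_intros)
      from DERIV_minus[OF DERIV_cdivide[OF this, of "b - 1"]]
      have "(?F has_real_derivative - ((1 - b) * (r\<^sup>2 + t) powr (1 - b - 1) * 1 / (b - 1))) (at t)" .
      moreover have "- ((1 - b) * (r\<^sup>2 + t) powr (1 - b - 1) * 1 / (b - 1)) = ?f t"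
        using b by (simp add: divide_simps) (simp add: algebra_simps)
      ultimately show ?thesis by simp
    qed
    show "0 \<le> ?f t" by simp
  next
    have "((\<lambda>t. (r\<^sup>2 + t) powr (1 - b)) \<longlongrightarrow> 0) at_top"
      using b by (intro tendsto_neg_powr filterlim_tendsto_add_at_top[OF tendsto_const filterlim_ident]) auto
    then have "(?F \<longlongrightarrow> - (0 / (b - 1))) at_top" using b by (intro tendsto_intros) auto
    then show "(?F \<longlongrightarrow> 0) at_top" by simp
  qed measurable
  have "(r\<^sup>2) powr (1 - b) = r powr (2 * (1 - b))"
    unfolding powr_powr[symmetric] using r by simp
  then have F0: "0 - ?F 0 = r powr (2 - 2 * b) / (b - 1)" by (simp add: algebra_simps)
  let ?w = "\<lambda>t. indicator {0<..} t * ?f t"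
  have "(\<integral>\<^sup>+t. ennreal (?w t) \<partial>lborel) \<le> (\<integral>\<^sup>+t. ennreal (?f t) * indicator {0 ..} t \<partial>lborel)"
    by (intro nn_integral_mono) (auto simp: indicator_def)
  then have le: "(\<integral>\<^sup>+t. ennreal (?w t) \<partial>lborel) \<le> ennreal (r powr (2 - 2 * b) / (b - 1))"
    by (simp only: nn F0)
  show "integrable lborel ?w"
  proof (rule integrableI_nonneg)
    show "(\<integral>\<^sup>+t. ennreal (?w t) \<partial>lborel) < \<infinity>"
      using le by (rule le_less_trans) simp
  qed auto
  show "(LINT t|lborel. ?w t) \<le> r powr (2 - 2 * b) / (b - 1)"
    using le b by (subst integral_eq_nn_integral) (auto intro!: enn2real_leI)
qed

lemma borel_measurable_quartic [measurable]: "quartic i \<in> borel_measurable borel"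
  unfolding quartic_def[abs_def] by measurable

lemma borel_measurable_heat_multiplier [measurable]:
  "(\<lambda>(t, \<xi>). heat_multiplier i m t \<xi>) \<in> borel_measurable (borel \<Otimes>\<^sub>M borel)"
  unfolding heat_multiplier_def by measurable

lemma borel_measurable_cofourier_heat_multiplier [measurable]:
  "(\<lambda>(t, x). cofourier (heat_multiplier i m t) x) \<in> borel_measurable (borel \<Otimes>\<^sub>M borel)"
  unfolding cofourier_def by measurable

text \<open>
  The kernel outside the unit ball, up to the factor \<open>(2\<pi>)\<^sup>-\<^sup>N\<close>; inside the ball the integral
  over \<open>t\<close> may diverge and the value is meaningless.
\<close>

definition kernel_fun :: "'n::finite \<Rightarrow> ('n \<Rightarrow> nat) \<Rightarrow> real ^ 'n \<Rightarrow> complex" where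
  "kernel_fun i m x = (LINT t|lborel. indicator {0<..} t *\<^sub>R cofourier (heat_multiplier i m t) x)"

lemma heat_slice_bound:
  assumes x: "1 \<le> norm x"
  shows "norm (indicator {0<..} t *\<^sub>R cofourier (heat_multiplier i m t) x) \<le>
    kernel_const m * (indicator {0<..} t * ((norm x)\<^sup>2 + t) powr (- (real (kernel_order m) / 2)))"
  using cofourier_heat_multiplier_decay[OF _ x, of t i m] by (cases "0 < t") auto

text \<open>
  A majorant independent of \<open>x\<close>, as dominated convergence and Fubini's theorem require.
\<close>

lemma heat_slice_uniform_bound:
  assumes x: "1 \<le> norm x"
  shows "norm (indicator {0<..} t *\<^sub>R cofourier (heat_multiplier i m t) x) \<le>
    kernel_const m * (indicator {0<..} t * (1\<^sup>2 + t) powr (- (real (kernel_order m) / 2)))"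
proof (cases "0 < t")
  case True
  have "1\<^sup>2 \<le> (norm x)\<^sup>2" using x by (intro power_mono) auto
  then have "((norm x)\<^sup>2 + t) powr (- (real (kernel_order m) / 2)) \<le> (1\<^sup>2 + t) powr (- (real (kernel_order m) / 2))"
    using True by (intro powr_mono2') auto
  then show ?thesis
    using heat_slice_bound[OF x, of t i m] True kernel_const_nonneg[of m]
    by (auto intro: order_trans mult_left_mono)
qed simp

lemma kernel_fun_decay:
  assumes n: "3 \<le> kernel_order m" and x: "1 \<le> norm x"
  shows "norm (kernel_fun i m x) \<le>
    kernel_const m * (norm x powr (2 - real (kernel_order m)) / (real (kernel_order m) / 2 - 1))"
proof -
  have x0: "0 < norm x" and b: "1 < real (kernel_order m) / 2" using x n by linarith+
  note w = time_weight[OF x0 b]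
  have "norm (kernel_fun i m x) \<le> (LINT t|lborel. kernel_const m * (indicator {0<..} t * ((norm x)\<^sup>2 + t) powr (- (real (kernel_order m) / 2))))"
    unfolding kernel_fun_def
    by (rule norm_integral_le_dominating[OF integrable_mult_right[OF w(1)] heat_slice_bound[OF x]])
  also have "\<dots> = kernel_const m * (LINT t|lborel. indicator {0<..} t * ((norm x)\<^sup>2 + t) powr (- (real (kernel_order m) / 2)))"
    by (rule integral_mult_right_zero)
  also have "\<dots> \<le> kernel_const m * (norm x powr (2 - 2 * (real (kernel_order m) / 2)) / (real (kernel_order m) / 2 - 1))"
    by (intro mult_left_mono w kernel_const_nonneg)
  finally show ?thesis by simp
qed

lemma continuous_on_kernel_fun:
  assumes n: "3 \<le> kernel_order m"
  shows "continuous_on (- ball 0 1) (kernel_fun i m)"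
  unfolding kernel_fun_def[abs_def]
proof (rule continuous_on_parametric_integral)
  have "1 < real (kernel_order m) / 2" using n by linarith
  then show "integrable lborel (\<lambda>t. kernel_const m * (indicator {0<..} t * (1\<^sup>2 + t) powr (- (real (kernel_order m) / 2))))"
    by (intro integrable_mult_right time_weight) auto
  show "continuous_on (- ball 0 1) (\<lambda>x. indicator {0<..} t *\<^sub>R cofourier (heat_multiplier i m t) x)" for t
    by (cases "0 < t") (auto intro!: continuous_on_cofourier heat_multiplier_L1)
  show "(\<lambda>t. indicator {0<..} t *\<^sub>R cofourier (heat_multiplier i m t) x) \<in> borel_measurable lborel" for x
    by measurable
qed (rule heat_slice_uniform_bound, simp add: dist_norm)

lemma integral_heat_multiplier:
  assumes "\<xi> \<noteq> 0"
  shows "(LINT t|lborel. indicator {0<..} t *\<^sub>R heat_multiplier i m t \<xi>) = of_real (monomial m \<xi> / quartic i \<xi>)"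
proof -
  have P: "0 < quartic i \<xi>" using assms by (auto simp: quartic_def intro!: add_pos_nonneg)
  have "(LINT t|lborel. indicator {0<..} t *\<^sub>R heat_multiplier i m t \<xi>) =
    (LINT t|lborel. of_real (monomial m \<xi> * (indicator {0<..} t * exp (- (t * quartic i \<xi>)))))"
    by (intro Bochner_Integration.integral_cong) (auto simp: heat_multiplier_def indicator_def)
  also have "\<dots> = of_real (monomial m \<xi> * (LINT t|lborel. indicator {0<..} t * exp (- (t * quartic i \<xi>))))"
    by (simp only: integral_complex_of_real integral_mult_right_zero)
  also have "(LINT t|lborel. indicator {0<..} t * exp (- (t * quartic i \<xi>))) = 1 / quartic i \<xi>"
    using LBINT_I0i_exp_mscale[OF P]
    by (simp add: interval_lebesgue_integral_0_infty set_lebesgue_integral_def)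
  finally show ?thesis by simp
qed

section \<open>Pairing the kernel with a function\<close>

text \<open>
  For small \<open>t\<close> the integral over \<open>\<xi>\<close> is bounded by the integral of the monomial times \<open>\<psi>\<close>, for large \<open>t\<close>
  by the supremum of \<open>\<psi>\<close> times the \<open>L\<^sup>1\<close> norm \<open>O(t\<^sup>-\<^sup>n\<^sup>/\<^sup>2)\<close> of the multiplier. The large times carry the singularity
  of the symbol at the origin, which is therefore integrable.
\<close>

lemma integrable_frequency_side:
  fixes \<psi> :: "real ^ 'n::finite \<Rightarrow> complex"
  assumes n: "3 \<le> kernel_order m" and \<psi>[measurable]: "\<psi> \<in> borel_measurable borel"
    and B: "\<And>\<xi>. norm (\<psi> \<xi>) \<le> B" and A: "integrable lborel (\<lambda>\<xi>. of_real (monomial m \<xi>) * \<psi> \<xi>)"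
  shows "integrable (lborel \<Otimes>\<^sub>M lborel) (\<lambda>(t, \<xi>). indicator {0<..} t *\<^sub>R (heat_multiplier i m t \<xi> * \<psi> \<xi>))"
proof (rule lborel_pair.Fubini_integrable)
  define \<beta> where "\<beta> = real (kernel_order m) / 2"
  \<comment> \<open>The factor \<open>2 powr \<beta>\<close> pays for passing from \<open>max 1 t\<close> to \<open>1 + t\<close>.\<close>
  define N where "N = max (LINT \<xi>|lborel. norm (of_real (monomial m \<xi>) * \<psi> \<xi>)) (B * heat_const m) * 2 powr \<beta>"
  have \<beta>: "1 < \<beta>" using n by (simp add: \<beta>_def)
  have B0: "0 \<le> B" using order_trans[OF norm_ge_zero B] .
  have P0: "0 \<le> quartic i \<xi>" for \<xi> by (simp add: quartic_def)
  have I: "integrable lborel (\<lambda>\<xi>. heat_multiplier i m t \<xi> * \<psi> \<xi>)" if "0 < t" for t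
  proof (rule Bochner_Integration.integrable_bound[OF A])
    show "AE \<xi> in lborel. norm (heat_multiplier i m t \<xi> * \<psi> \<xi>) \<le> norm (of_real (monomial m \<xi>) * \<psi> \<xi>)"
      using that P0 by (auto simp: heat_multiplier_def norm_mult abs_mult intro!: mult_right_mono mult_right_le_one_le)
  qed measurable
  have bound: "(LINT \<xi>|lborel. norm (heat_multiplier i m t \<xi> * \<psi> \<xi>)) \<le> N * (1\<^sup>2 + t) powr (- \<beta>)" if t: "0 < t" for t
  proof -
    let ?J = "LINT \<xi>|lborel. norm (heat_multiplier i m t \<xi> * \<psi> \<xi>)"
    let ?M = "max (LINT \<xi>|lborel. norm (of_real (monomial m \<xi>) * \<psi> \<xi>)) (B * heat_const m)"
    have M0: "0 \<le> ?M" using B0 heat_const_nonneg[of m] by (simp add: max.coboundedI2)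
    have J1: "?J \<le> ?M"
    proof -
      have "?J \<le> (LINT \<xi>|lborel. norm (of_real (monomial m \<xi>) * \<psi> \<xi>))"
        using t P0 by (intro integral_mono integrable_norm I A t)
          (auto simp: heat_multiplier_def norm_mult abs_mult intro!: mult_right_mono mult_right_le_one_le)
      then show ?thesis by simp
    qed
    have J2: "?J \<le> ?M * (1 / sqrt t) ^ kernel_order m"
    proof -
      have "?J \<le> (LINT \<xi>|lborel. norm (heat_multiplier i m t \<xi>) * B)"
        by (intro integral_mono integrable_norm I t integrable_mult_left heat_multiplier_L1)
          (simp add: norm_mult mult_left_mono B)
      also have "\<dots> \<le> (heat_const m * (1 / sqrt t) ^ kernel_order m) * B"
        using heat_multiplier_L1(2)[OF t, of i m] B0 by (simp add: mult_right_mono)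
      also have "\<dots> = (B * heat_const m) * (1 / sqrt t) ^ kernel_order m" by simp
      also have "\<dots> \<le> ?M * (1 / sqrt t) ^ kernel_order m" using t by (intro mult_right_mono) auto
      finally show ?thesis .
    qed
    \<comment> \<open>Both bounds together decay like \<open>max 1 t\<close> to the power \<open>- \<beta>\<close>, and \<open>max 1 t \<ge> (1 + t) / 2\<close>.\<close>
    have sq: "(1 / sqrt t) ^ kernel_order m = t powr (- \<beta>)"
    proof -
      have "(1 / sqrt t) ^ kernel_order m = (t powr (- (1/2))) powr real (kernel_order m)"
        using t by (simp add: powr_realpow powr_minus powr_half_sqrt inverse_eq_divide)
      then show ?thesis by (simp add: powr_powr \<beta>_def)
    qed
    have "(max 1 t) powr (- \<beta>) \<le> ((1 + t) / 2) powr (- \<beta>)"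
      using t \<beta> by (intro powr_mono2') auto
    also have "\<dots> = 2 powr \<beta> * (1\<^sup>2 + t) powr (- \<beta>)"
      using t by (simp add: powr_divide powr_minus field_simps)
    finally have "?M * (max 1 t) powr (- \<beta>) \<le> ?M * (2 powr \<beta> * (1\<^sup>2 + t) powr (- \<beta>))"
      by (rule mult_left_mono[OF _ M0])
    moreover have "?J \<le> ?M * (max 1 t) powr (- \<beta>)"
      using J1 J2 unfolding sq by (cases "t \<le> 1") (auto simp: max_def)
    ultimately show ?thesis unfolding N_def mult.assoc by linarith
  qed
  have "integrable lborel (\<lambda>t. N * (indicator {0<..} t * (1\<^sup>2 + t) powr (- \<beta>)))"
    by (intro integrable_mult_right time_weight \<beta>) auto
  then show "integrable lborel (\<lambda>t. LINT \<xi>|lborel. norm (case (t, \<xi>) of (t, \<xi>) \<Rightarrow> indicator {0<..} t *\<^sub>R (heat_multiplier i m t \<xi> * \<psi> \<xi>)))"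
  proof (rule Bochner_Integration.integrable_bound)
    show "AE t in lborel. norm (LINT \<xi>|lborel. norm (case (t, \<xi>) of (t, \<xi>) \<Rightarrow> indicator {0<..} t *\<^sub>R (heat_multiplier i m t \<xi> * \<psi> \<xi>)))
        \<le> norm (N * (indicator {0<..} t * (1\<^sup>2 + t) powr (- \<beta>)))"
    proof (rule AE_I2)
      fix t :: real
      show "norm (LINT \<xi>|lborel. norm (case (t, \<xi>) of (t, \<xi>) \<Rightarrow> indicator {0<..} t *\<^sub>R (heat_multiplier i m t \<xi> * \<psi> \<xi>)))
        \<le> norm (N * (indicator {0<..} t * (1\<^sup>2 + t) powr (- \<beta>)))"
      proof (cases "0 < t")
        case True
        then show ?thesis
          using order_trans[OF bound[OF True] abs_ge_self] by (simp add: integral_nonneg_AE)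
      qed simp
    qed
  qed measurable
  show "AE t in lborel. integrable lborel (\<lambda>\<xi>. case (t, \<xi>) of (t, \<xi>) \<Rightarrow> indicator {0<..} t *\<^sub>R (heat_multiplier i m t \<xi> * \<psi> \<xi>))"
  proof (rule AE_I2)
    fix t :: real
    show "integrable lborel (\<lambda>\<xi>. case (t, \<xi>) of (t, \<xi>) \<Rightarrow> indicator {0<..} t *\<^sub>R (heat_multiplier i m t \<xi> * \<psi> \<xi>))"
      using I[of t] by (cases "0 < t") auto
  qed
qed measurable

text \<open>
  It is essential that \<open>\<phi>\<close> vanishes inside the unit ball, where the kernel may have a singularity.
\<close>

lemma integrable_space_side:
  fixes \<phi> :: "real ^ 'n::finite \<Rightarrow> complex"
  assumes n: "3 \<le> kernel_order m" and \<phi>: "integrable lborel \<phi>" and supp: "\<And>x. norm x < 1 \<Longrightarrow> \<phi> x = 0"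
  shows "integrable (lborel \<Otimes>\<^sub>M lborel)
    (\<lambda>(t, x). indicator {0<..} t *\<^sub>R (cofourier (heat_multiplier i m t) x * \<phi> x))"
proof -
  have [measurable]: "\<phi> \<in> borel_measurable borel" using \<phi> by auto
  have b: "1 < real (kernel_order m) / 2" using n by linarith
  define w where "w t = kernel_const m * (indicator {0<..} t * (1\<^sup>2 + t) powr (- (real (kernel_order m) / 2)))" for t
  have w: "integrable lborel w" unfolding w_def
    by (intro integrable_mult_right time_weight b) auto
  have w0: "0 \<le> w t" for t by (simp add: w_def kernel_const_nonneg)
  have [measurable]: "w \<in> borel_measurable borel" using w by auto
  have "integrable (lborel \<Otimes>\<^sub>M lborel) (\<lambda>(t, x). w t *\<^sub>R norm (\<phi> x))"
  proof (rule lborel_pair.Fubini_integrable)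
    show "integrable lborel (\<lambda>t. LINT x|lborel. norm (case (t, x) of (t, x) \<Rightarrow> w t *\<^sub>R norm (\<phi> x)))"
      using w w0 by simp
    show "AE t in lborel. integrable lborel (\<lambda>x. case (t, x) of (t, x) \<Rightarrow> w t *\<^sub>R norm (\<phi> x))"
      using \<phi> by simp
  qed measurable
  then show ?thesis
  proof (rule Bochner_Integration.integrable_bound)
    show "AE p in lborel \<Otimes>\<^sub>M lborel. norm (case p of (t, x) \<Rightarrow> indicator {0<..} t *\<^sub>R (cofourier (heat_multiplier i m t) x * \<phi> x)) \<le>
        norm (case p of (t, x) \<Rightarrow> w t *\<^sub>R norm (\<phi> x))"
    proof (rule AE_I2, clarify)
      fix t :: real and x :: "real ^ 'n"
      show "norm (indicator {0<..} t *\<^sub>R (cofourier (heat_multiplier i m t) x * \<phi> x)) \<le> norm (w t *\<^sub>R norm (\<phi> x))"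
      proof (cases "1 \<le> norm x")
        case True
        have "norm (indicator {0<..} t *\<^sub>R cofourier (heat_multiplier i m t) x) * norm (\<phi> x) \<le> w t * norm (\<phi> x)"
          unfolding w_def by (intro mult_right_mono heat_slice_uniform_bound True) auto
        then show ?thesis using w0[of t] by (simp add: norm_mult mult.assoc)
      qed (simp add: supp)
    qed
  qed measurable
qed

lemma pairing_with_kernel_fun:
  fixes \<phi> :: "real ^ 'n::finite \<Rightarrow> complex"
  assumes n: "3 \<le> kernel_order m" and \<phi>: "integrable lborel \<phi>" and supp: "\<And>x. norm x < 1 \<Longrightarrow> \<phi> x = 0"
    and A: "integrable lborel (\<lambda>\<xi>. of_real (monomial m \<xi>) * cofourier \<phi> \<xi>)"
  shows "(LINT \<xi>|lborel. of_real (monomial m \<xi> / quartic i \<xi>) * cofourier \<phi> \<xi>) =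
    (LINT x|lborel. kernel_fun i m x * \<phi> x)"
proof -
  let ?g = "heat_multiplier i m" and ?\<psi> = "cofourier \<phi>"
  have [measurable]: "\<phi> \<in> borel_measurable borel" using \<phi> by auto
  note F1 = integrable_frequency_side[OF n borel_measurable_cofourier norm_cofourier_le A, of i, simplified]
  note F2 = integrable_space_side[OF n \<phi> supp, of i, simplified]
  have "(LINT \<xi>|lborel. of_real (monomial m \<xi> / quartic i \<xi>) * ?\<psi> \<xi>) =
      (LINT \<xi>|lborel. LINT t|lborel. indicator {0<..} t *\<^sub>R (?g t \<xi> * ?\<psi> \<xi>))"
  proof (rule integral_cong_AE)
    \<comment> \<open>At the origin \<open>quartic\<close> vanishes and the integral over \<open>t\<close> need not be the quotient.\<close>
    show "AE \<xi> in lborel. of_real (monomial m \<xi> / quartic i \<xi>) * ?\<psi> \<xi> =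
        (LINT t|lborel. indicator {0<..} t *\<^sub>R (?g t \<xi> * ?\<psi> \<xi>))"
      using AE_lborel_singleton[of 0]
    proof eventually_elim
      case (elim \<xi>)
      show ?case
        unfolding integral_heat_multiplier[OF elim, of i m, symmetric] integral_mult_left_zero[symmetric]
        by (simp only: mult_scaleR_left)
    qed
  qed measurable
  also have "\<dots> = (LINT t|lborel. LINT \<xi>|lborel. indicator {0<..} t *\<^sub>R (?g t \<xi> * ?\<psi> \<xi>))"
    by (rule lborel_pair.Fubini_integral[OF F1])
  also have "\<dots> = (LINT t|lborel. LINT x|lborel. indicator {0<..} t *\<^sub>R (cofourier (?g t) x * \<phi> x))"
  proof (rule Bochner_Integration.integral_cong[OF refl])
    fix t :: real
    show "(LINT \<xi>|lborel. indicator {0<..} t *\<^sub>R (?g t \<xi> * ?\<psi> \<xi>)) =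
        (LINT x|lborel. indicator {0<..} t *\<^sub>R (cofourier (?g t) x * \<phi> x))"
      using multiplication_formula[OF heat_multiplier_L1(1) \<phi>, of t i m] by (cases "0 < t") auto
  qed
  also have "\<dots> = (LINT x|lborel. LINT t|lborel. indicator {0<..} t *\<^sub>R (cofourier (?g t) x * \<phi> x))"
    by (rule lborel_pair.Fubini_integral[OF F2, symmetric])
  also have "\<dots> = (LINT x|lborel. kernel_fun i m x * \<phi> x)"
    unfolding kernel_fun_def integral_mult_left_zero[symmetric] by (simp only: mult_scaleR_left)
  finally show ?thesis .
qed

section \<open>Decay of the kernels\<close>

text \<open>
  A test function is the Fourier transform of a Schwartz function, so the hypothesis on the Fourier
  transform of \<open>T\<close> determines the value of \<open>T\<close> there; the value is a pairing on the frequency side,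
  which \<open>pairing_with_kernel_fun\<close> moves to the space side.
\<close>

theorem kernel_decay:
  fixes i :: "'n::finite" and T :: "'n functional"
  assumes n: "3 \<le> kernel_order m"
    and T: "tempered_eq (fourier_dist T) (regular_dist (\<lambda>\<xi>. of_real (monomial m \<xi> / quartic i \<xi>)))"
  shows "\<exists>f. coincides_on T (- ball 0 1) f \<and> continuous_on (- ball 0 1) f \<and>
    f \<in> M_infty (real (kernel_order m) - 2) (- ball 0 1)"
proof (intro exI conjI)
  let ?c = "complex_of_real (1 / (2 * pi) ^ CARD('n))"
  define f where "f x = ?c * kernel_fun i m x" for x
  show cont: "continuous_on (- ball 0 1) f"
    unfolding f_def by (intro continuous_intros continuous_on_kernel_fun n)
  show "coincides_on T (- ball 0 1) f"
    unfolding coincides_on_def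
  proof (intro conjI allI impI ballI)
    fix K :: "(real ^ 'n) set" assume "compact K \<and> K \<subseteq> - ball 0 1"
    then show "set_integrable lborel K f"
      unfolding set_integrable_def
      by (intro borel_integrable_compact continuous_on_subset[OF cont]) auto
  next
    fix \<phi> :: "real ^ 'n \<Rightarrow> complex" assume \<phi>: "\<phi> \<in> test_functions (- ball 0 1)"
    then have S: "\<phi> \<in> smooth_compact" using test_functions_smooth_compact by blast
    have supp: "\<phi> x = 0" if "norm x < 1" for x
    proof -
      have "x \<notin> closure {x. \<phi> x \<noteq> 0}" using \<phi> that by (auto simp: test_functions_def)
      then show ?thesis using closure_subset[of "{x. \<phi> x \<noteq> 0}"] by auto
    qed
    let ?\<phi> = "\<lambda>x. ?c * \<phi> x"
    have c: "?\<phi> \<in> smooth_compact" by (rule smooth_compact_scale[OF S])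
    have "T \<phi> = T (fourier (cofourier ?\<phi>))" by (simp only: fourier_cofourier_smooth_compact[OF S])
    also have "\<dots> = regular_dist (\<lambda>\<xi>. of_real (monomial m \<xi> / quartic i \<xi>)) (cofourier ?\<phi>)"
      using T cofourier_schwartz[OF c] unfolding tempered_eq_def fourier_dist_def by blast
    also have "\<dots> = (LINT x|lborel. kernel_fun i m x * ?\<phi> x)"
      unfolding regular_dist_def
      by (rule pairing_with_kernel_fun[OF n smooth_compact_integrable[OF c] _ integrable_monomial_cofourier[OF c]])
         (simp add: supp)
    also have "\<dots> = regular_dist f \<phi>" by (simp add: regular_dist_def f_def mult_ac)
    finally show "T \<phi> = regular_dist f \<phi>" .
  qed
  let ?n = "real (kernel_order m)"
  show "f \<in> M_infty (?n - 2) (- ball 0 1)"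
    unfolding M_infty_def
  proof (intro CollectI bdd_aboveI2)
    fix x :: "real ^ 'n" assume "x \<in> - ball 0 1"
    then have x: "1 \<le> norm x" by (simp add: dist_norm)
    have "norm x powr (?n - 2) * norm (f x) = norm ?c * (norm x powr (?n - 2) * norm (kernel_fun i m x))"
      unfolding f_def norm_mult by (simp only: mult.left_commute)
    also have "\<dots> \<le> norm ?c * (norm x powr (?n - 2) * (kernel_const m * (norm x powr (2 - ?n) / (?n / 2 - 1))))"
      by (intro mult_left_mono kernel_fun_decay n x) auto
    also have "\<dots> = norm ?c * (kernel_const m / (?n / 2 - 1) * (norm x powr (?n - 2) * norm x powr (2 - ?n)))"
      by simp
    also have "norm x powr (?n - 2) * norm x powr (2 - ?n) = 1"
    proof -
      have "x \<noteq> 0" using x by auto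
      then show ?thesis by (simp flip: powr_add)
    qed
    finally show "norm x powr (?n - 2) * norm (f x) \<le> norm ?c * (kernel_const m / (?n / 2 - 1) * 1)" .
  qed
qed

lemma monomial_single: "monomial (\<lambda>l. if l = i then a else 0) \<xi> = (\<xi> $ i) ^ a"
  unfolding monomial_def by (simp add: if_distrib[of "\<lambda>n. _ ^ n"] cong: if_cong)

lemma monomial_add: "monomial (\<lambda>l. p l + q l) \<xi> = monomial p \<xi> * monomial q \<xi>"
  by (simp add: monomial_def power_add prod.distrib)

theorem theorem3:
  fixes i1 k :: "'n::finite"
    and H0 K0 Kk :: "(real ^ 'n \<Rightarrow> complex) \<Rightarrow> complex"
  assumes "CARD('n) \<ge> 2"
    and "tempered_distribution H0" and "tempered_eq (fourier_dist H0) (regular_dist (H0_hat i1))"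
    and "tempered_distribution K0" and "tempered_eq (fourier_dist K0) (regular_dist (K0_hat i1))"
    and "tempered_distribution Kk" and "tempered_eq (fourier_dist Kk) (regular_dist (Kk_hat i1 k))"
  shows "(\<exists>f. coincides_on H0 (- ball 0 1) f \<and> continuous_on (- ball 0 1) f \<and>
              f \<in> M_infty (real CARD('n) - 1) (- ball 0 1)) \<and>
         (\<exists>f. coincides_on K0 (- ball 0 1) f \<and> continuous_on (- ball 0 1) f \<and>
              f \<in> M_infty (real CARD('n)) (- ball 0 1)) \<and>
         (\<exists>f. coincides_on Kk (- ball 0 1) f \<and> continuous_on (- ball 0 1) f \<and>
              f \<in> M_infty (real CARD('n) + 1) (- ball 0 1))"
proof (intro conjI)
  let ?e = "\<lambda>i a l :: 'n. if l = i then a else 0 :: nat"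
  have H: "H0_hat i1 = (\<lambda>\<xi>. of_real (monomial (?e i1 1) \<xi> / quartic i1 \<xi>))"
    by (simp add: fun_eq_iff H0_hat_def quartic_def monomial_single)
  have K: "K0_hat i1 = (\<lambda>\<xi>. of_real (monomial (?e i1 2) \<xi> / quartic i1 \<xi>))"
    by (simp add: fun_eq_iff K0_hat_def quartic_def monomial_single)
  have L: "Kk_hat i1 k = (\<lambda>\<xi>. of_real (monomial (\<lambda>l. ?e k 1 l + ?e i1 2 l) \<xi> / quartic i1 \<xi>))"
    by (simp add: fun_eq_iff Kk_hat_def quartic_def monomial_add monomial_single)
  have o: "kernel_order (?e i1 1) = CARD('n) + 1" "kernel_order (?e i1 2) = CARD('n) + 2"
    "kernel_order (\<lambda>l. ?e k 1 l + ?e i1 2 l) = CARD('n) + 3"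
    by (simp_all add: kernel_order_def sum.distrib)
  show "\<exists>f. coincides_on H0 (- ball 0 1) f \<and> continuous_on (- ball 0 1) f \<and>
              f \<in> M_infty (real CARD('n) - 1) (- ball 0 1)"
    using kernel_decay[of "?e i1 1" H0 i1] assms(1,3) unfolding H o by simp
  show "\<exists>f. coincides_on K0 (- ball 0 1) f \<and> continuous_on (- ball 0 1) f \<and>
              f \<in> M_infty (real CARD('n)) (- ball 0 1)"
    using kernel_decay[of "?e i1 2" K0 i1] assms(1,5) unfolding K o by simp
  show "\<exists>f. coincides_on Kk (- ball 0 1) f \<and> continuous_on (- ball 0 1) f \<and>
              f \<in> M_infty (real CARD('n) + 1) (- ball 0 1)"
    using kernel_decay[of "\<lambda>l. ?e k 1 l + ?e i1 2 l" Kk i1] assms(1,7) unfolding L o by (simp add: add.commute)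
qed

end
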